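(* Let $A_1,\dots,A_m,C\in\mathbb{Z}^{n\times n}$ be symmetric matrices and $b\in\mathbb{Z}^m$, let $(S_{\mathrm{KKT}})$ be the associated KKT polynomial system, whose equations have coefficients of bitsize at most $\tau$, and let $(\widehat S_{\mathrm{KKT}})$ be the associated squared-up system. Let $\gamma$ be an isolated solution of the polynomial system $(\widehat S_{\mathrm{KKT}})$ (and hence an isolated solution of $(S_{\mathrm{KKT}})$). Let $N=n(n+1)+m$ and $$\tau_1=\tau+N+\lg p=\tau+(n(n+1)+m)+\lg\Bigl(m+\frac{3n^2+n}{2}\Bigr).$$ Then, for every nonzero coordinate $\gamma_k\ne0$, it holds that $$2^{-\eta_1}\le|\gamma_k|\le 2^{\eta_1},$$ where $$\eta_1=\frac{N^2-N}{2}+2^N+N(\tau+N+2)\,2^{N-1}=\widetilde{\mathcal{O}}\bigl(n^4\,m^2\,2^{n(n+1)+m}\,\tau\bigr),$$ and the $\widetilde{\mathcal{O}}(\cdot)$ notation ignores the (poly)logarithmic factors.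
   Context: $\mathcal{S}_n$ is the space of real symmetric $n\times n$ matrices, $\langle A,B\rangle=\operatorname{tr}(AB)$, $[m]=\{1,\dots,m\}$, and $\lg$ is the logarithm in base $2$. The SDP pair considered is $\min_{X\in\mathcal{S}_n}\langle C,X\rangle$ s.t. $\langle A_i,X\rangle=b_i$ ($i\in[m]$), $X\succeq0$, and $\max_{y\in\mathbb{R}^m}b^Ty$ s.t. $S:=C-\sum_{i=1}^m y_iA_i\succeq0$. Ignoring the semidefinite inequalities, the KKT system in the unknowns $(X,S,y)\in\mathcal{S}_n\times\mathcal{S}_n\times\mathbb{R}^m$ is $$(S_{\mathrm{KKT}}):\quad \langle A_i,X\rangle-b_i=0\ (i\in[m]),\qquad S-C+\sum_{i=1}^m y_iA_i=0,\qquad XS=0.$$ It has $N=n(n+1)+m$ scalar variables and $p=m+\frac{n(n+1)}2+n^2=m+\frac{3n^2+n}{2}$ scalar equations of total degree at most $2$. Squared-up system: $(\widehat S_{\mathrm{KKT}})$ is a square polynomial system consisting of $N$ generic integer linear combinations of the $p$ equations of $(S_{\mathrm{KKT}})$, chosen (by a result of Giusti and Heintz) so that every irreducible component of the variety of $(\widehat S_{\mathrm{KKT}})$ is either a component of the variety of $(S_{\mathrm{KKT}})$ or an isolated point; in particular, all isolated solutions of $(S_{\mathrm{KKT}})$ are preserved. If the coefficients of the original equations have bitsize at most $\tau$, the squared-up system has coefficients of bitsize at most $\tau_1=\tau+N+\lg p$.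
   Formalization: The parenthetical "and hence an isolated solution of (S_KKT)" is neither assumed nor claimed: the squared-up system can have extra isolated solutions that do not solve (S_KKT). The bounds are stated for every isolated solution of the squared-up system. *)

theory Defs
  imports
    "HOL-Analysis.Analysis"
    "HOL-Library.Poly_Mapping"
    "HOL-Library.Uprod"
    "HOL-Library.Landau_Symbols"
begin

section \<open>Multivariate polynomials and varieties\<close>

text \<open>A monomial is a finitely supported exponent vector, a polynomial a finitely supported
  coefficient function on monomials; the product of \<^typ>\<open>'a \<Rightarrow>\<^sub>0 'b\<close> is convolution.\<close>

type_synonym ('v, 'a) mpoly = "('v \<Rightarrow>\<^sub>0 nat) \<Rightarrow>\<^sub>0 'a"

definition mvar :: "'v \<Rightarrow> ('v, 'a::comm_ring_1) mpoly" where
  "mvar v = Poly_Mapping.single (Poly_Mapping.single v 1) 1"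

definition mconst :: "'a \<Rightarrow> ('v, 'a::comm_ring_1) mpoly" where
  "mconst c = Poly_Mapping.single 0 c"

definition complex_mpoly :: "('v, int) mpoly \<Rightarrow> ('v, complex) mpoly" where
  "complex_mpoly f = Poly_Mapping.map of_int f"

definition meval :: "('v::finite, complex) mpoly \<Rightarrow> complex ^ 'v \<Rightarrow> complex" where
  "meval f z = (\<Sum>a\<in>Poly_Mapping.keys f.
     Poly_Mapping.lookup f a * (\<Prod>v\<in>UNIV. (z $ v) ^ Poly_Mapping.lookup a v))"

definition zero_set :: "('v::finite, complex) mpoly set \<Rightarrow> (complex ^ 'v) set" where
  "zero_set P = {z. \<forall>f\<in>P. meval f z = 0}"

definition algebraic_set :: "(complex ^ 'v::finite) set \<Rightarrow> bool" where
  "algebraic_set Z \<longleftrightarrow> (\<exists>P. Z = zero_set P)"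

definition irreducible_algebraic_set :: "(complex ^ 'v::finite) set \<Rightarrow> bool" where
  "irreducible_algebraic_set Z \<longleftrightarrow> algebraic_set Z \<and> Z \<noteq> {} \<and>
     (\<forall>Z1 Z2. algebraic_set Z1 \<longrightarrow> algebraic_set Z2 \<longrightarrow> Z = Z1 \<union> Z2 \<longrightarrow> Z = Z1 \<or> Z = Z2)"

definition irreducible_component ::
  "(complex ^ 'v::finite) set \<Rightarrow> (complex ^ 'v) set \<Rightarrow> bool" where
  "irreducible_component Z V \<longleftrightarrow> irreducible_algebraic_set Z \<and> Z \<subseteq> V \<and>
     (\<forall>Z'. irreducible_algebraic_set Z' \<longrightarrow> Z \<subseteq> Z' \<longrightarrow> Z' \<subseteq> V \<longrightarrow> Z' = Z)"

text \<open>An integer \<open>a\<close> has bitsize at most \<open>t\<close> if \<open>\<bar>a\<bar> \<le> 2\<^sup>t\<close>. The bound \<open>t\<close> is real because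
  it is applied to \<open>\<tau> + N + lg p\<close>.\<close>

definition coeffs_bitsize_le :: "('v, int) mpoly \<Rightarrow> real \<Rightarrow> bool" where
  "coeffs_bitsize_le f t \<longleftrightarrow> (\<forall>a. \<bar>real_of_int (Poly_Mapping.lookup f a)\<bar> \<le> 2 powr t)"


section \<open>The KKT system\<close>

instance uprod :: (finite) finite
  by standard simp

text \<open>A symmetric matrix over \<open>'n\<close> has one scalar variable for each unordered pair of
  (possibly equal) indices.\<close>

datatype ('n, 'm) kkt_var = XVar "'n uprod" | SVar "'n uprod" | YVar 'm

datatype ('n, 'm) kkt_index = Primal 'm | Dual "'n uprod" | Compl 'n 'n

lemma UNIV_kkt_var: "UNIV = range XVar \<union> range SVar \<union> range YVar"
proof (intro set_eqI iffI UNIV_I)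
  fix x :: "('a, 'b) kkt_var"
  show "x \<in> range XVar \<union> range SVar \<union> range YVar"
    by (cases x) auto
qed

lemma UNIV_kkt_index: "UNIV = range Primal \<union> range Dual \<union> range (\<lambda>(i, j). Compl i j)"
proof (intro set_eqI iffI UNIV_I)
  fix x :: "('a, 'b) kkt_index"
  show "x \<in> range Primal \<union> range Dual \<union> range (\<lambda>(i, j). Compl i j)"
    by (cases x) auto
qed

instance kkt_var :: (finite, finite) finite
  by standard (simp add: UNIV_kkt_var)

instance kkt_index :: (finite, finite) finite
  by standard (simp add: UNIV_kkt_index)

definition kkt_N :: "nat \<Rightarrow> nat \<Rightarrow> nat" where
  "kkt_N n m = n * (n + 1) + m"

definition kkt_p :: "nat \<Rightarrow> nat \<Rightarrow> nat" where
  "kkt_p n m = m + (3 * n\<^sup>2 + n) div 2"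

lemma card_kkt_var: "CARD(('n::finite, 'm::finite) kkt_var) = kkt_N CARD('n) CARD('m)"
proof -
  have "even (CARD('n) * (CARD('n) + 1))"
    by simp
  moreover have "card (range XVar \<union> range SVar \<union> range (YVar :: 'm \<Rightarrow> ('n, 'm) kkt_var)) =
      CARD('n uprod) + CARD('n uprod) + CARD('m)"
    by (subst card_Un_disjoint, simp, simp, force, subst card_Un_disjoint)
       (auto simp: card_image inj_on_def)
  ultimately show ?thesis
    unfolding UNIV_kkt_var kkt_N_def card_UNIV_uprod by presburger
qed

lemma card_kkt_index: "CARD(('n::finite, 'm::finite) kkt_index) = kkt_p CARD('n) CARD('m)"
proof -
  have "card (range Primal \<union> range Dual \<union>
      range ((\<lambda>(i, j). Compl i j) :: 'n \<times> 'n \<Rightarrow> ('n, 'm) kkt_index)) =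
      CARD('m) + CARD('n uprod) + CARD('n \<times> 'n)"
    by (subst card_Un_disjoint, simp, simp, force, subst card_Un_disjoint)
       (auto simp: card_image inj_on_def)
  moreover have "CARD('n) * (CARD('n) + 1) div 2 + CARD('n) * CARD('n) =
      (3 * (CARD('n))\<^sup>2 + CARD('n)) div 2"
    by (simp add: power2_eq_square algebra_simps)
  ultimately show ?thesis
    unfolding UNIV_kkt_index kkt_p_def card_UNIV_uprod by simp
qed

text \<open>The choice of an ordered representative is immaterial when \<open>M\<close> is symmetric.\<close>

definition sym_entry :: "'a ^ 'n ^ 'n \<Rightarrow> 'n uprod \<Rightarrow> 'a" where
  "sym_entry M u = (let (i, j) = (SOME (i, j). u = Upair i j) in M $ i $ j)"

lemma sym_entry_Upair:
  assumes "transpose M = M"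
  shows "sym_entry M (Upair i j) = M $ i $ j"
proof -
  define q where "q = (SOME (k, l). Upair i j = Upair k l)"
  have "case q of (k, l) \<Rightarrow> Upair i j = Upair k l"
    unfolding q_def by (rule someI[of _ "(i, j)"]) simp
  moreover have "M $ j $ i = M $ i $ j"
    using assms by (metis transpose_def vec_lambda_beta)
  ultimately show ?thesis
    unfolding sym_entry_def q_def[symmetric] by (auto split: prod.splits)
qed

definition mconst_mat :: "int ^ 'n ^ 'n \<Rightarrow> ('v, int) mpoly ^ 'n ^ 'n" where
  "mconst_mat M = (\<chi> i j. mconst (M $ i $ j))"

definition X_mat :: "(('n, 'm) kkt_var, int) mpoly ^ 'n ^ 'n" where
  "X_mat = (\<chi> i j. mvar (XVar (Upair i j)))"

definition S_mat :: "(('n, 'm) kkt_var, int) mpoly ^ 'n ^ 'n" where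
  "S_mat = (\<chi> i j. mvar (SVar (Upair i j)))"

definition dual_mat ::
  "('m::finite \<Rightarrow> int ^ 'n ^ 'n) \<Rightarrow> int ^ 'n ^ 'n \<Rightarrow> (('n, 'm) kkt_var, int) mpoly ^ 'n ^ 'n" where
  "dual_mat A C = S_mat - mconst_mat C +
     (\<Sum>i\<in>UNIV. \<chi> k l. mvar (YVar i) * mconst (A i $ k $ l))"

lemma transpose_dual_mat:
  fixes A :: "'m::finite \<Rightarrow> int ^ 'n::finite ^ 'n"
  assumes "\<And>i. transpose (A i) = A i" and "transpose C = C"
  shows "transpose (dual_mat A C) = dual_mat A C"
proof -
  have A: "A i $ k $ l = A i $ l $ k" for i k l
    using arg_cong[OF assms(1), of "\<lambda>M. M $ l $ k" i] by (simp add: transpose_def)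
  have C: "C $ k $ l = C $ l $ k" for k l
    using arg_cong[OF assms(2), of "\<lambda>M. M $ l $ k"] by (simp add: transpose_def)
  have S: "Upair k l = Upair l k" for k l :: 'n
    by simp
  have "dual_mat A C $ k $ l = dual_mat A C $ l $ k" for k l
    unfolding dual_mat_def S_mat_def mconst_mat_def vector_add_component
      vector_minus_component sum_component vec_lambda_beta
      A[of _ k l] C[of k l] S[of k l] by (rule refl)
  then show ?thesis
    unfolding vec_eq_iff transpose_def vec_lambda_beta by blast
qed

primrec kkt_poly ::
  "('m::finite \<Rightarrow> int ^ 'n::finite ^ 'n) \<Rightarrow> int ^ 'm \<Rightarrow> int ^ 'n ^ 'n \<Rightarrow>
     ('n, 'm) kkt_index \<Rightarrow> (('n, 'm) kkt_var, int) mpoly" where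
  "kkt_poly A b C (Primal i) = trace (mconst_mat (A i) ** X_mat) - mconst (b $ i)"
| "kkt_poly A b C (Dual u) = sym_entry (dual_mat A C) u"
| "kkt_poly A b C (Compl i j) = (X_mat ** S_mat) $ i $ j"

definition kkt_variety ::
  "('m::finite \<Rightarrow> int ^ 'n::finite ^ 'n) \<Rightarrow> int ^ 'm \<Rightarrow> int ^ 'n ^ 'n \<Rightarrow>
     (complex ^ ('n, 'm) kkt_var) set" where
  "kkt_variety A b C = zero_set (complex_mpoly ` range (kkt_poly A b C))"


section \<open>The squared-up system\<close>

definition tau1 :: "nat \<Rightarrow> nat \<Rightarrow> nat \<Rightarrow> real" where
  "tau1 n m \<tau> = real \<tau> + real (kkt_N n m) + log 2 (real (kkt_p n m))"

text \<open>The system consists of the polynomials \<open>F k\<close> with \<open>k < N\<close>. Genericity of the combinations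
  \<open>L\<close> enters only through the condition on the irreducible components.\<close>

definition system_variety ::
  "(nat \<Rightarrow> (('n::finite, 'm::finite) kkt_var, int) mpoly) \<Rightarrow> (complex ^ ('n, 'm) kkt_var) set" where
  "system_variety F = zero_set (complex_mpoly ` F ` {..<kkt_N CARD('n) CARD('m)})"

definition squared_up_system ::
  "('m::finite \<Rightarrow> int ^ 'n::finite ^ 'n) \<Rightarrow> int ^ 'm \<Rightarrow> int ^ 'n ^ 'n \<Rightarrow> nat \<Rightarrow>
     (nat \<Rightarrow> (('n, 'm) kkt_var, int) mpoly) \<Rightarrow> bool" where
  "squared_up_system A b C \<tau> F \<longleftrightarrow>
     (\<exists>L :: nat \<Rightarrow> ('n, 'm) kkt_index \<Rightarrow> int. \<forall>k < kkt_N CARD('n) CARD('m).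
        F k = (\<Sum>e\<in>UNIV. mconst (L k e) * kkt_poly A b C e)) \<and>
     (\<forall>k < kkt_N CARD('n) CARD('m). coeffs_bitsize_le (F k) (tau1 CARD('n) CARD('m) \<tau>)) \<and>
     (\<forall>Z. irreducible_component Z (system_variety F) \<longrightarrow>
        irreducible_component Z (kkt_variety A b C) \<or>
        (\<exists>z. Z = {z} \<and> z isolated_in system_variety F))"


section \<open>The exponent\<close>

definition eta1 :: "nat \<Rightarrow> nat \<Rightarrow> nat \<Rightarrow> real" where
  "eta1 n m \<tau> = (let N = kkt_N n m in
     ((real N)\<^sup>2 - real N) / 2 + 2 ^ N + real N * (real \<tau> + real N + 2) * 2 ^ (N - 1))"

text \<open>Soft-O in three positive integer parameters: the bound is uniform over all positive values,
  up to a fixed power of the logarithm of the parameters themselves (and not of \<open>g\<close>, which may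
  be exponential in them).\<close>

definition soft_bigo :: "(nat \<times> nat \<times> nat \<Rightarrow> real) \<Rightarrow> (nat \<times> nat \<times> nat \<Rightarrow> real) set" where
  "soft_bigo g = {f. \<exists>k :: nat.
     f \<in> O[principal {(n, m, t). n \<ge> 1 \<and> m \<ge> 1 \<and> t \<ge> 1}](
       \<lambda>(n, m, t). g (n, m, t) * log 2 (real (n + m + t)) ^ k)}"

end

theory Submission
  imports Defs
begin

text \<open>Each of the \<open>N\<close> polynomials \<open>F\<^sub>v\<close> is affine in \<open>(X, S, y)\<close> up to products of an entry of \<open>X\<close>
  with an entry of \<open>S\<close>.

  By Siegel's lemma there is a nonzero integer polynomial \<open>W(w, T)\<close> of degree at most \<open>M\<close> with
  small coefficients such that \<open>W(F(x), x\<^sub>k) = 0\<close> identically. The unknowns are the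
  \<open>binomial(M + N + 1, N + 1)\<close> coefficients of \<open>W\<close>. The equations are indexed by the monomials of
  degree at most \<open>M\<close> jointly in \<open>(X, y)\<close> and jointly in \<open>(S, y)\<close>; their number is at most
  \<open>binomial(2a, a) * binomial(M + N, N)\<close> with \<open>a = n(n + 1)/2\<close>, where \<open>binomial(2a, a) \<le> 2\<^bsup>N - 2\<^esup>\<close>.
  As \<open>M\<close> tends to infinity the height of \<open>W\<close> stays below \<open>2\<^bsup>\<eta>\<^esup>\<close>.

  The polynomial \<open>W(0, T)\<close> may vanish, so \<open>F(x) = w\<close> is solved near \<open>\<gamma>\<close> along a monomial curve
  \<open>w\<^sub>v = e\<^bsup>\<omega> v\<^esup>\<close> on which distinct monomials in \<open>w\<close> have distinct orders. In the limit
  \<open>e \<rightarrow> 0\<close> the coefficient \<open>P(T)\<close> of the lowest-order monomial of \<open>W\<close> vanishes at \<open>\<gamma>\<^sub>k\<close>, and the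
  bounds follow from the height of \<open>P\<close>.

  Solvability of \<open>F(x) = w\<close> near an isolated zero is shown by perturbing \<open>F\<close> so that its Jacobian
  is invertible at \<open>\<gamma>\<close>: the critical values then lie in an algebraic hypersurface, the complement of
  which in a small ball is connected and dense, and the image is open and closed there.\<close>

section \<open>Polynomial functions\<close>

text \<open>The index is only an upper bound for the degree: \<open>const\<close> and
  \<open>var\<close> allow any slack, so a bound can always be raised. With functions in place of
  formal polynomials, derivatives and restrictions to lines are handled by induction on this
  predicate.\<close>

inductive polyfun :: "nat \<Rightarrow> (complex ^ 'v::finite \<Rightarrow> complex) \<Rightarrow> bool" where
  const: "polyfun d (\<lambda>_. c)"
| var: "polyfun (Suc d) (\<lambda>x. x $ v)"
| add: "polyfun d f \<Longrightarrow> polyfun d g \<Longrightarrow> polyfun d (\<lambda>x. f x + g x)"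
| mult: "polyfun d f \<Longrightarrow> polyfun e g \<Longrightarrow> polyfun (d + e) (\<lambda>x. f x * g x)"

lemma polyfun_mono:
  assumes "polyfun d f" "d \<le> e"
  shows "polyfun e f"
  using polyfun.mult[OF assms(1) polyfun.const[of "e - d" 1]] assms(2) by simp

lemma polyfun_sum:
  assumes "\<And>i. i \<in> I \<Longrightarrow> polyfun d (f i)"
  shows "polyfun d (\<lambda>x. \<Sum>i\<in>I. f i x)"
  using assms by (induction I rule: infinite_finite_induct) (auto intro: polyfun.intros)

lemma polyfun_prod:
  assumes "\<And>i. i \<in> I \<Longrightarrow> polyfun (d i) (f i)"
  shows "polyfun (sum d I) (\<lambda>x. \<Prod>i\<in>I. f i x)"
  using assms by (induction I rule: infinite_finite_induct) (auto intro: polyfun.intros)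

lemma polyfun_power:
  assumes "polyfun d f"
  shows "polyfun (n * d) (\<lambda>x. f x ^ n)"
  by (induction n) (auto intro: polyfun.intros assms)

text \<open>The partial derivatives keep the bound \<open>d\<close> itself, which fits the product
  rule without truncated subtraction.\<close>

lemma polyfun_has_derivative:
  fixes f :: "complex ^ 'v::finite \<Rightarrow> complex"
  assumes "polyfun d f"
  shows "\<exists>g. (\<forall>v. polyfun d (g v)) \<and>
    (\<forall>x. (f has_derivative (\<lambda>h. \<Sum>v\<in>UNIV. g v x * h $ v)) (at x))"
  using assms
proof induction
  case (const d c)
  show ?case
    by (rule exI[of _ "\<lambda>_ _. 0"]) (auto intro: polyfun.intros)
next
  case (var d v)
  have "((\<lambda>x. x $ v) has_derivative (\<lambda>h. \<Sum>u\<in>UNIV. (if u = v then 1 else 0) * h $ u)) (at x)"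
    for x :: "complex ^ 'v"
    by (auto simp: if_distrib[of "\<lambda>c. c * _"] sum.delta intro!: bounded_linear_imp_has_derivative
        bounded_linear_vec_nth cong: if_cong)
  then show ?case
    by (intro exI[of _ "\<lambda>u _. if u = v then 1 else 0"]) (auto intro: polyfun.const)
next
  case (add d f g)
  from add.IH(1) obtain f' where f: "\<And>v. polyfun d (f' v)"
      "\<And>x. (f has_derivative (\<lambda>h. \<Sum>v\<in>UNIV. f' v x * h $ v)) (at x)"
    by blast
  from add.IH(2) obtain g' where g: "\<And>v. polyfun d (g' v)"
      "\<And>x. (g has_derivative (\<lambda>h. \<Sum>v\<in>UNIV. g' v x * h $ v)) (at x)"
    by blast
  have "((\<lambda>x. f x + g x) has_derivative (\<lambda>h. \<Sum>v\<in>UNIV. (f' v x + g' v x) * h $ v)) (at x)" for x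
    using has_derivative_add[OF f(2) g(2)] by (simp add: sum.distrib distrib_right)
  then show ?case
    by (intro exI[of _ "\<lambda>v x. f' v x + g' v x"]) (auto intro: polyfun.add f g)
next
  case (mult d f e g)
  from mult.IH(1) obtain f' where f: "\<And>v. polyfun d (f' v)"
      "\<And>x. (f has_derivative (\<lambda>h. \<Sum>v\<in>UNIV. f' v x * h $ v)) (at x)"
    by blast
  from mult.IH(2) obtain g' where g: "\<And>v. polyfun e (g' v)"
      "\<And>x. (g has_derivative (\<lambda>h. \<Sum>v\<in>UNIV. g' v x * h $ v)) (at x)"
    by blast
  have *: "((\<lambda>x. f x * g x) has_derivative (\<lambda>h. \<Sum>v\<in>UNIV. (f x * g' v x + f' v x * g x) * h $ v)) (at x)" for x
    using has_derivative_mult[OF f(2) g(2)]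
    by (simp add: sum.distrib algebra_simps sum_distrib_left)
  then show ?case
    by (intro exI[of _ "\<lambda>v x. f x * g' v x + f' v x * g x"] conjI allI polyfun.add
        polyfun.mult mult.hyps f g)
qed

lemma polyfun_continuous:
  assumes "polyfun d f"
  shows "continuous_on S f"
proof -
  obtain g where "\<And>x. (f has_derivative (\<lambda>h. \<Sum>v\<in>UNIV. g v x * h $ v)) (at x)"
    using polyfun_has_derivative[OF assms] by blast
  then show ?thesis
    by (intro continuous_at_imp_continuous_on ballI has_derivative_continuous)
qed

lemma polyfun_line:
  assumes "polyfun d f"
  shows "\<exists>p. \<forall>t. f (a + t *s b) = poly p t"
  using assms
proof induction
  case (const d c)
  show ?case
    by (rule exI[of _ "[:c:]"]) simp
next
  case (var d v)
  show ?case
    by (rule exI[of _ "[:a $ v, b $ v:]"]) simp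
next
  case (add d f g)
  then show ?case
    by (metis poly_add)
next
  case (mult d f e g)
  then show ?case
    by (metis poly_mult)
qed

lemma polyfun_line_zeros:
  assumes "polyfun d f" "f x \<noteq> 0" "x = a + s *s b"
  shows "finite {t. f (a + t *s b) = 0}"
proof -
  obtain p where p: "\<And>t. f (a + t *s b) = poly p t"
    using polyfun_line[OF assms(1)] by blast
  have "p \<noteq> 0"
    using p[of s] assms by auto
  then show ?thesis
    unfolding p by (rule poly_roots_finite)
qed

lemma continuous_on_complex_line:
  "continuous_on S (\<lambda>t :: complex. a + t *s (b :: complex ^ 'v::finite))"
proof -
  have *: "(\<lambda>t. a + t *s b) = (\<lambda>t. \<chi> i. (a $ i) + t * (b $ i))"
    by (simp add: fun_eq_iff vec_eq_iff)
  show ?thesis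
    unfolding * by (auto intro!: continuous_intros)
qed

text \<open>On the complex line through \<open>x0\<close> and \<open>x1\<close> the function is a
  univariate polynomial, nonzero at parameter 1, so it has finitely many roots; the parameters
  landing in \<open>U\<close> form a nonempty open set, which is infinite.\<close>

lemma polyfun_nonzero_dense:
  assumes f: "polyfun d f" "f x1 \<noteq> 0" and U: "open U" "x0 \<in> U"
  shows "\<exists>y\<in>U. f y \<noteq> 0"
proof -
  let ?l = "\<lambda>t. x0 + t *s (x1 - x0)"
  have "finite {t. f (?l t) = 0}"
    by (rule polyfun_line_zeros[OF f, where s = 1]) simp
  moreover have "open (?l -` U)"
    by (rule open_vimage[OF U(1) continuous_on_complex_line])
  moreover have "0 \<in> ?l -` U"
    using U(2) by simp
  ultimately have "\<not> ?l -` U \<subseteq> {t. f (?l t) = 0}"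
    using finite_imp_not_open[OF finite_subset] by (metis empty_iff)
  then show ?thesis
    by auto
qed

text \<open>Two points of the set lie on a complex line. The parameters landing in \<open>U\<close>
  form a convex open subset of the plane, which stays connected after finitely many points are
  removed.\<close>

lemma polyfun_nonzero_connected:
  assumes f: "polyfun d f" and U: "open U" "convex U"
  shows "connected {x \<in> U. f x \<noteq> 0}"
  unfolding connected_iff_connected_component
proof (intro ballI)
  fix x y assume xy: "x \<in> {x \<in> U. f x \<noteq> 0}" "y \<in> {x \<in> U. f x \<noteq> 0}"
  let ?l = "\<lambda>t. x + t *s (y - x)"
  have "finite {t. f (?l t) = 0}"
    by (rule polyfun_line_zeros[OF f, where x = x and s = 0]) (use xy in auto)
  moreover have "open (?l -` U)"
    by (rule open_vimage[OF U(1) continuous_on_complex_line])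
  moreover have "convex (?l -` U)"
  proof (rule convexI)
    fix s t :: complex and u v :: real
    assume st: "s \<in> ?l -` U" "t \<in> ?l -` U" and uv: "0 \<le> u" "0 \<le> v" "u + v = 1"
    have v: "v = 1 - u"
      using uv by simp
    have "?l (u *\<^sub>R s + v *\<^sub>R t) = u *\<^sub>R ?l s + v *\<^sub>R ?l t"
      unfolding v vec_eq_iff by simp (simp add: scaleR_conv_of_real[where 'a = complex] algebra_simps)
    then show "u *\<^sub>R s + v *\<^sub>R t \<in> ?l -` U"
      using convexD[OF U(2), of "?l s" "?l t" u v] st uv by simp
  qed
  ultimately have "connected (?l -` U - {t. f (?l t) = 0})"
    by (intro connected_open_delete_finite) (auto simp: convex_connected)
  then have "connected (?l ` (?l -` U - {t. f (?l t) = 0}))"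
    by (intro connected_continuous_image continuous_on_complex_line)
  moreover have "?l 0 \<in> ?l ` (?l -` U - {t. f (?l t) = 0})" "?l 1 \<in> ?l ` (?l -` U - {t. f (?l t) = 0})"
    using xy by (intro imageI; simp)+
  ultimately show "connected_component {x \<in> U. f x \<noteq> 0} x y"
    unfolding connected_component_def
    by (intro exI[of _ "?l ` (?l -` U - {t. f (?l t) = 0})"]) auto
qed

section \<open>Linear systems and expansions in monomials\<close>

text \<open>Elimination, one equation at a time: if some unknown \<open>j\<close> occurs in equation
  \<open>r\<close>, it is solved for and the remaining equations are rewritten in the other
  unknowns.\<close>

lemma linear_dependence:
  fixes c :: "'i \<Rightarrow> 'r \<Rightarrow> complex"
  assumes "finite R" "finite I" "card R < card I"
  shows "\<exists>w. (\<exists>i\<in>I. w i \<noteq> 0) \<and> (\<forall>r\<in>R. (\<Sum>i\<in>I. w i * c i r) = 0)"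
  using assms
proof (induction R arbitrary: I c rule: finite_induct)
  case empty
  then obtain i where "i \<in> I"
    by fastforce
  then show ?case
    by (intro exI[of _ "\<lambda>_. 1"]) auto
next
  case (insert r R)
  show ?case
  proof (cases "\<forall>i\<in>I. c i r = 0")
    case True
    moreover obtain w where "\<exists>i\<in>I. w i \<noteq> 0" "\<forall>r\<in>R. (\<Sum>i\<in>I. w i * c i r) = 0"
      using insert.IH[of I c] insert.prems insert.hyps by auto
    ultimately show ?thesis
      by (intro exI[of _ w]) auto
  next
    case False
    then obtain j where j: "j \<in> I" "c j r \<noteq> 0"
      by blast
    define q where "q i = c i r / c j r" for i
    have "card R < card (I - {j})" "finite (I - {j})"
      using insert.prems insert.hyps j(1) by auto
    from insert.IH[of "I - {j}" "\<lambda>i s. c i s - q i * c j s", OF this(2,1)]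
    obtain w where w: "\<exists>i\<in>I - {j}. w i \<noteq> 0"
      "\<forall>s\<in>R. (\<Sum>i\<in>I - {j}. w i * (c i s - q i * c j s)) = 0"
      by blast
    \<comment> \<open>The value at \<open>j\<close> is forced by equation \<open>r\<close>; with it
      every equation agrees with its reduced form.\<close>
    define w' where "w' = w(j := - (\<Sum>i\<in>I - {j}. w i * q i))"
    have *: "(\<Sum>i\<in>I. w' i * c i s) = (\<Sum>i\<in>I - {j}. w i * (c i s - q i * c j s))" for s
    proof -
      have "(\<Sum>i\<in>I. w' i * c i s) = w' j * c j s + (\<Sum>i\<in>I - {j}. w' i * c i s)"
        using insert.prems(1) j(1) by (rule sum.remove)
      also have "(\<Sum>i\<in>I - {j}. w' i * c i s) = (\<Sum>i\<in>I - {j}. w i * c i s)"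
        by (intro sum.cong) (auto simp: w'_def)
      finally show ?thesis
        by (simp add: w'_def sum_subtractf algebra_simps sum_distrib_left sum_distrib_right)
    qed
    have "(\<Sum>i\<in>I. w' i * c i r) = 0"
      using j(2) by (simp add: * q_def)
    then have "\<forall>s\<in>insert r R. (\<Sum>i\<in>I. w' i * c i s) = 0"
      using w(2) * by auto
    moreover have "\<exists>i\<in>I. w' i \<noteq> 0"
      using w(1) by (auto simp: w'_def)
    ultimately show ?thesis
      by blast
  qed
qed

definition mono_eval :: "('v \<Rightarrow> nat) \<Rightarrow> complex ^ 'v::finite \<Rightarrow> complex" where
  "mono_eval a x = (\<Prod>v\<in>UNIV. (x $ v) ^ a v)"

lemma mono_eval_add: "mono_eval (\<lambda>v. a v + b v) x = mono_eval a x * mono_eval b x"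
  by (simp add: mono_eval_def power_add prod.distrib)

definition convolution ::
  "('v \<Rightarrow> nat) set \<Rightarrow> ('v \<Rightarrow> nat) set \<Rightarrow> (('v \<Rightarrow> nat) \<Rightarrow> 'a::comm_ring_1) \<Rightarrow> (('v \<Rightarrow> nat) \<Rightarrow> 'a) \<Rightarrow>
     ('v \<Rightarrow> nat) \<Rightarrow> 'a" where
  "convolution P Q c d k = (\<Sum>(a, b)\<in>{(a, b)\<in>P \<times> Q. (\<lambda>v. a v + b v) = k}. c a * d b)"

lemma convolution_mono_eval:
  assumes "finite P" "finite Q" "finite R" "\<And>a b. a \<in> P \<Longrightarrow> b \<in> Q \<Longrightarrow> (\<lambda>v. a v + b v) \<in> R"
  shows "(\<Sum>a\<in>P. c a * mono_eval a x) * (\<Sum>b\<in>Q. d b * mono_eval b x) =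
    (\<Sum>k\<in>R. convolution P Q c d k * mono_eval k x)"
proof -
  have "(\<Sum>a\<in>P. c a * mono_eval a x) * (\<Sum>b\<in>Q. d b * mono_eval b x) =
      (\<Sum>(a, b)\<in>P \<times> Q. c a * d b * mono_eval (\<lambda>v. a v + b v) x)"
    by (simp add: sum_product sum.cartesian_product mono_eval_add mult_ac)
  also have "\<dots> = (\<Sum>k\<in>R. \<Sum>(a, b)\<in>{p \<in> P \<times> Q. (\<lambda>(a, b) v. a v + b v) p = k}.
      c a * d b * mono_eval (\<lambda>v. a v + b v) x)"
    using assms by (intro sum.group[symmetric]) auto
  also have "\<dots> = (\<Sum>k\<in>R. convolution P Q c d k * mono_eval k x)"
    unfolding convolution_def sum_distrib_right
    by (intro sum.cong) auto
  finally show ?thesis .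
qed

text \<open>A box in place of a degree simplex: its size is a plain power, and bounded digits allow
  an injective positional encoding of exponents.\<close>

definition exp_box :: "nat \<Rightarrow> ('v::finite \<Rightarrow> nat) set" where
  "exp_box M = {a. \<forall>v. a v \<le> M}"

lemma exp_box_PiE: "exp_box M = (\<Pi>\<^sub>E v\<in>UNIV. {..M})"
  by (auto simp: exp_box_def PiE_def extensional_def)

lemma finite_exp_box [simp]: "finite (exp_box M)"
  by (simp add: exp_box_PiE finite_PiE)

lemma card_exp_box: "card (exp_box M :: ('v::finite \<Rightarrow> nat) set) = Suc M ^ CARD('v)"
  by (simp add: exp_box_PiE card_PiE)

lemma mono_eval_zero [simp]: "mono_eval (\<lambda>_. 0) x = 1"
  by (simp add: mono_eval_def)

lemma mono_eval_unit [simp]: "mono_eval (\<lambda>u. if u = v then 1 else 0) x = x $ v"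
  by (simp add: mono_eval_def if_distrib cong: if_cong)

lemma sum_mono_eval_delta:
  assumes "finite B" "b \<in> B"
  shows "(\<Sum>a\<in>B. (if a = b then c else 0) * mono_eval a x) = c * mono_eval b x"
proof -
  have "(\<Sum>a\<in>B. (if a = b then c else 0) * mono_eval a x) = (\<Sum>a\<in>B. if a = b then c * mono_eval b x else 0)"
    by (intro sum.cong) auto
  then show ?thesis
    using assms by simp
qed

lemma polyfun_mono_eval: "polyfun (sum a UNIV) (mono_eval a)"
proof -
  have "polyfun (a v) (\<lambda>x. (x $ v) ^ a v)" for v
    using polyfun_power[OF polyfun.var[of 0 v], of "a v"] by simp
  then show ?thesis
    unfolding mono_eval_def by (rule polyfun_prod)
qed

lemma polyfun_expansion:
  fixes f :: "complex ^ 'v::finite \<Rightarrow> complex"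
  assumes "polyfun d f"
  shows "\<exists>c. \<forall>x. f x = (\<Sum>a\<in>exp_box d. c a * mono_eval a x)"
  using assms
proof induction
  case (const d c)
  have "(\<lambda>_. 0) \<in> exp_box d"
    by (simp add: exp_box_def)
  then have "c = (\<Sum>a\<in>exp_box d. (if a = (\<lambda>_. 0) then c else 0) * mono_eval a x)" for x :: "complex ^ 'v"
    by (subst sum_mono_eval_delta) simp_all
  then show ?case
    by (intro exI[of _ "\<lambda>a. if a = (\<lambda>_. 0) then c else 0"] allI)
next
  case (var d v)
  let ?u = "\<lambda>u. if u = v then 1 else 0 :: nat"
  have "?u \<in> exp_box (Suc d)"
    by (simp add: exp_box_def)
  then have "x $ v = (\<Sum>a\<in>exp_box (Suc d). (if a = ?u then 1 else 0) * mono_eval a x)" for x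
    by (subst sum_mono_eval_delta) simp_all
  then show ?case
    by (intro exI[of _ "\<lambda>a. if a = ?u then 1 else 0"] allI)
next
  case (add d f g)
  from add.IH(1) obtain c where "\<And>x. f x = (\<Sum>a\<in>exp_box d. c a * mono_eval a x)"
    by blast
  moreover from add.IH(2) obtain c' where "\<And>x. g x = (\<Sum>a\<in>exp_box d. c' a * mono_eval a x)"
    by blast
  ultimately show ?case
    by (intro exI[of _ "\<lambda>a. c a + c' a"]) (simp add: distrib_right sum.distrib)
next
  case (mult d f e g)
  from mult.IH(1) obtain c where c: "\<And>x. f x = (\<Sum>a\<in>exp_box d. c a * mono_eval a x)"
    by blast
  from mult.IH(2) obtain c' where c': "\<And>x. g x = (\<Sum>a\<in>exp_box e. c' a * mono_eval a x)"
    by blast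
  have "f x * g x = (\<Sum>a\<in>exp_box (d + e). convolution (exp_box d) (exp_box e) c c' a * mono_eval a x)" for x
    unfolding c c'
    by (rule convolution_mono_eval[OF finite_exp_box finite_exp_box finite_exp_box])
      (auto simp: exp_box_def add_mono)
  then show ?case
    by blast
qed

section \<open>Monomial curves and lowest-order terms\<close>

text \<open>Mixed-radix encoding: the weight \<open>W\<close> of a new variable exceeds the total
  that the earlier ones can contribute, so the remainder modulo \<open>W\<close> recovers that
  total. Positive weights make the curve \<open>e ^ w v\<close> pass through the origin at
  \<open>e = 0\<close>.\<close>

lemma exponent_weights:
  assumes "finite V"
  shows "\<exists>w :: 'v \<Rightarrow> nat. (\<forall>v. w v > 0) \<and> (\<forall>a b. (\<forall>v\<in>V. a v \<le> M \<and> b v \<le> M) \<longrightarrow>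
    (\<Sum>v\<in>V. a v * w v) = (\<Sum>v\<in>V. b v * w v) \<longrightarrow> (\<forall>v\<in>V. a v = b v))"
  using assms
proof (induction V rule: finite_induct)
  case empty
  show ?case
    by (intro exI[of _ "\<lambda>_. 1"]) auto
next
  case (insert u V)
  from insert.IH obtain w :: "'v \<Rightarrow> nat" where w: "\<And>v. w v > 0" "\<And>a b. (\<forall>v\<in>V. a v \<le> M \<and> b v \<le> M) \<Longrightarrow>
    (\<Sum>v\<in>V. a v * w v) = (\<Sum>v\<in>V. b v * w v) \<Longrightarrow> (\<forall>v\<in>V. a v = b v)"
    by blast
  define W where "W = Suc (M * (\<Sum>v\<in>V. w v))"
  define w' where "w' = w(u := W)"
  have sum: "(\<Sum>v\<in>insert u V. a v * w' v) = a u * W + (\<Sum>v\<in>V. a v * w v)" for a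
    using insert.hyps by (auto simp: w'_def intro!: sum.cong)
  have less: "(\<Sum>v\<in>V. a v * w v) < W" if "\<forall>v\<in>V. a v \<le> M" for a
    unfolding W_def sum_distrib_left less_Suc_eq_le
    by (intro sum_mono mult_right_mono) (use that in auto)
  have inj: "\<forall>v\<in>insert u V. a v = b v"
    if ab: "\<forall>v\<in>insert u V. a v \<le> M \<and> b v \<le> M"
      and eq: "(\<Sum>v\<in>insert u V. a v * w' v) = (\<Sum>v\<in>insert u V. b v * w' v)" for a b
  proof -
    have l: "(\<Sum>v\<in>V. a v * w v) < W" "(\<Sum>v\<in>V. b v * w v) < W"
      using ab less by auto
    have eq': "a u * W + (\<Sum>v\<in>V. a v * w v) = b u * W + (\<Sum>v\<in>V. b v * w v)"
      using eq unfolding sum .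
    have "(\<Sum>v\<in>V. a v * w v) = (\<Sum>v\<in>V. b v * w v)"
      using arg_cong[OF eq', of "\<lambda>x. x mod W"] l by simp
    moreover from this have "a u * W = b u * W"
      using eq' by linarith
    then have "a u = b u"
      unfolding mult_cancel2 W_def by blast
    ultimately show ?thesis
      using w(2)[of a b] ab by (simp only: ball_simps) blast
  qed
  have "w' v > 0" for v
    using w(1) by (simp add: w'_def W_def)
  then show ?case
    by (intro exI[of _ w'] conjI allI impI) (simp, rule inj)
qed

text \<open>Identically vanishing coefficients are dropped; among the others the least weight is
  attained once, by injectivity. Dividing by its power of \<open>e\<close> leaves all other terms
  with a positive power, so only \<open>q i0 t\<close> survives in the limit.\<close>

lemma lowest_term_vanishes:
  fixes q :: "'i \<Rightarrow> complex \<Rightarrow> complex" and wt :: "'i \<Rightarrow> nat"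
  assumes J: "finite J" "inj_on wt J"
    and cont: "\<And>i. i \<in> J \<Longrightarrow> isCont (q i) t"
    and ex: "\<exists>i\<in>J. q i \<noteq> (\<lambda>_. 0)"
    and e: "\<And>n. e n \<noteq> 0" "e \<longlonglongrightarrow> 0"
    and s: "s \<longlonglongrightarrow> t"
    and eq: "\<And>n. (\<Sum>i\<in>J. q i (s n) * e n ^ wt i) = 0"
  shows "\<exists>i\<in>J. q i \<noteq> (\<lambda>_. 0) \<and> q i t = 0"
proof -
  define Z where "Z = {i\<in>J. q i \<noteq> (\<lambda>_. 0)}"
  obtain i0 where i0: "i0 \<in> Z" "\<And>i. i \<in> Z \<Longrightarrow> wt i0 \<le> wt i"
    using ex_has_least_nat[of "\<lambda>i. i \<in> Z" _ wt] ex Z_def by blast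
  have Z: "finite Z" "Z \<subseteq> J"
    using J(1) by (auto simp: Z_def)
  have lt: "wt i0 < wt i" if "i \<in> Z - {i0}" for i
  proof -
    have "wt i0 \<noteq> wt i"
      using that i0(1) Z(2) J(2) by (auto dest: inj_onD)
    then show ?thesis
      using i0(2)[of i] that by simp
  qed
  have 0: "(\<Sum>i\<in>Z. q i (s n) * e n ^ (wt i - wt i0)) = 0" for n
  proof -
    have "e n ^ wt i0 * (\<Sum>i\<in>Z. q i (s n) * e n ^ (wt i - wt i0)) =
        (\<Sum>i\<in>Z. q i (s n) * e n ^ wt i)"
      unfolding sum_distrib_left
    proof (rule sum.cong)
      fix i assume "i \<in> Z"
      then have "e n ^ wt i = e n ^ wt i0 * e n ^ (wt i - wt i0)"
        using i0(2) by (simp flip: power_add)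
      then show "e n ^ wt i0 * (q i (s n) * e n ^ (wt i - wt i0)) = q i (s n) * e n ^ wt i"
        by simp
    qed simp
    also have "\<dots> = (\<Sum>i\<in>J. q i (s n) * e n ^ wt i)"
      using J(1) by (intro sum.mono_neutral_left) (auto simp: Z_def)
    finally show ?thesis
      using eq e(1)[of n] by simp
  qed
  have "(\<lambda>n. \<Sum>i\<in>Z. q i (s n) * e n ^ (wt i - wt i0)) \<longlonglongrightarrow> (\<Sum>i\<in>Z. q i t * 0 ^ (wt i - wt i0))"
    using Z cont by (intro tendsto_sum tendsto_mult tendsto_power e(2)) (auto intro: isCont_tendsto_compose[OF _ s])
  moreover have "(\<Sum>i\<in>Z. q i t * 0 ^ (wt i - wt i0)) = q i0 t + (\<Sum>i\<in>Z - {i0}. q i t * 0 ^ (wt i - wt i0))"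
    using i0(1) Z(1) by (subst sum.remove[of _ i0]) auto
  moreover have "(\<Sum>i\<in>Z - {i0}. q i t * 0 ^ (wt i - wt i0)) = 0"
  proof (intro sum.neutral ballI)
    fix i assume "i \<in> Z - {i0}"
    from lt[OF this] show "q i t * 0 ^ (wt i - wt i0) = 0"
      by (simp add: zero_power)
  qed
  ultimately have "(\<lambda>n. 0) \<longlonglongrightarrow> q i0 t"
    unfolding 0 by simp
  then have "q i0 t = 0"
    by (simp add: LIMSEQ_const_iff)
  then show ?thesis
    using i0(1) Z_def by blast
qed

text \<open>On the curve \<open>x $ v = e ^ w v\<close> distinct monomials of the box become
  distinct powers of \<open>e\<close>, so a nonzero coefficient contradicts the lowest-term argument
  with constant \<open>q\<close>.\<close>

lemma mono_eval_independent:
  fixes c :: "('v::finite \<Rightarrow> nat) \<Rightarrow> complex"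
  assumes zero: "\<And>x. (\<Sum>a\<in>exp_box M. c a * mono_eval a x) = 0" and a: "a \<in> exp_box M"
  shows "c a = 0"
proof (rule ccontr)
  assume ca: "c a \<noteq> 0"
  obtain w :: "'v \<Rightarrow> nat" where w: "\<And>a b. (\<forall>v\<in>UNIV. a v \<le> M \<and> b v \<le> M) \<Longrightarrow>
      (\<Sum>v\<in>UNIV. a v * w v) = (\<Sum>v\<in>UNIV. b v * w v) \<Longrightarrow> (\<forall>v\<in>UNIV. a v = b v)"
    using exponent_weights[of "UNIV :: 'v set" M] by auto
  define e :: "nat \<Rightarrow> complex" where "e n = of_real (inverse (real (Suc n)))" for n
  have e: "e n \<noteq> 0" for n
    by (simp add: e_def del: of_nat_Suc)
  have e0: "e \<longlonglongrightarrow> 0"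
    unfolding e_def using tendsto_of_real[OF LIMSEQ_inverse_real_of_nat] of_real_0 by metis
  have "inj_on (\<lambda>a. \<Sum>v\<in>UNIV. a v * w v) (exp_box M)"
    using w by (intro inj_onI ext) (auto simp: exp_box_def)
  moreover have "(\<Sum>a\<in>exp_box M. c a * e n ^ (\<Sum>v\<in>UNIV. a v * w v)) = 0" for n
    using zero[of "\<chi> v. e n ^ w v"]
    by (simp add: mono_eval_def power_sum mult.commute flip: power_mult)
  moreover have "\<exists>a\<in>exp_box M. (\<lambda>_::complex. c a) \<noteq> (\<lambda>_. 0)"
    using ca a by (auto simp: fun_eq_iff)
  ultimately have "\<exists>a\<in>exp_box M. (\<lambda>_::complex. c a) \<noteq> (\<lambda>_. 0) \<and> c a = 0"
    by (intro lowest_term_vanishes[where q = "\<lambda>a _. c a" and e = e and s = "\<lambda>_. 0" and t = 0]) (auto simp: e e0)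
  then show False
    by auto
qed

section \<open>Polynomial maps near an isolated zero\<close>

text \<open>\<open>CARD('v) + 1\<close> polynomials in \<open>CARD('v)\<close> variables are
  algebraically dependent: their products with exponents at most \<open>M\<close> outnumber the
  monomials that can occur in them.\<close>

lemma algebraic_relation:
  fixes f :: "'v::finite \<Rightarrow> complex ^ 'v \<Rightarrow> complex"
  assumes f: "\<And>v. polyfun d (f v)" and D: "polyfun d D"
  shows "\<exists>M c. (\<exists>a\<in>exp_box M. \<exists>b\<le>M. c a b \<noteq> 0) \<and>
    (\<forall>x. (\<Sum>b\<le>M. (\<Sum>a\<in>exp_box M. c a b * mono_eval a (\<chi> v. f v x)) * D x ^ b) = 0)"
proof -
  define n where "n = CARD('v)"
  \<comment> \<open>\<open>K\<close> bounds the degree of the products, and \<open>m\<close> is such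
    that \<open>Suc K \<le> m * Suc M\<close>. Then \<open>M = m ^ n\<close> gives
    \<open>Suc K ^ n \<le> M * Suc M ^ n < Suc M ^ Suc n\<close>, the number of products.\<close>
  define m where "m = Suc (Suc n * d)"
  define M where "M = m ^ n"
  define K where "K = Suc n * M * d"
  have K: "K = (\<Sum>v\<in>(UNIV :: 'v set). M * d) + M * d"
    by (simp add: K_def n_def algebra_simps)
  define I where "I = (exp_box M :: ('v \<Rightarrow> nat) set) \<times> {..M}"
  define \<Phi> where "\<Phi> = (\<lambda>(a, b) x. mono_eval a (\<chi> v. f v x) * D x ^ b)"
  have "\<exists>c. \<forall>x. \<Phi> i x = (\<Sum>k\<in>exp_box K. c k * mono_eval k x)" if "i \<in> I" for i
  proof -
    obtain a b where i: "i = (a, b)" "a \<in> exp_box M" "b \<le> M"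
      using \<open>i \<in> I\<close> by (auto simp: I_def)
    have "polyfun (\<Sum>v\<in>UNIV. a v * d) (\<lambda>x. \<Prod>v\<in>UNIV. f v x ^ a v)"
      by (intro polyfun_prod polyfun_power f)
    from polyfun.mult[OF this polyfun_power[OF D, of b]]
    have "polyfun ((\<Sum>v\<in>UNIV. a v * d) + b * d) (\<Phi> i)"
      by (simp add: \<Phi>_def i mono_eval_def)
    moreover have "(\<Sum>v\<in>UNIV. a v * d) \<le> (\<Sum>v\<in>(UNIV::'v set). M * d)"
      using i(2) by (intro sum_mono mult_right_mono) (auto simp: exp_box_def)
    then have "(\<Sum>v\<in>UNIV. a v * d) + b * d \<le> K"
      unfolding K by (intro add_mono mult_right_mono i(3)) simp_all
    ultimately show ?thesis
      using polyfun_expansion polyfun_mono by blast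
  qed
  then obtain c where c: "\<And>i x. i \<in> I \<Longrightarrow> \<Phi> i x = (\<Sum>k\<in>exp_box K. c i k * mono_eval k x)"
    by metis
  have "card (exp_box K :: ('v \<Rightarrow> nat) set) < card I"
  proof -
    have "Suc K \<le> m * Suc M"
      by (simp add: K_def m_def algebra_simps)
    then have "Suc K ^ n \<le> (m * Suc M) ^ n"
      by (rule power_mono) simp
    also have "\<dots> = M * Suc M ^ n"
      by (simp only: power_mult_distrib M_def)
    also have "\<dots> < Suc M * Suc M ^ n"
      by simp
    finally show ?thesis
      by (simp add: I_def card_cartesian_product card_exp_box n_def mult.commute)
  qed
  moreover have "finite I"
    by (simp add: I_def)
  ultimately obtain w where w: "\<exists>i\<in>I. w i \<noteq> 0" "\<And>k. k \<in> exp_box K \<Longrightarrow> (\<Sum>i\<in>I. w i * c i k) = 0"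
    using linear_dependence[of "exp_box K" I c] by auto
  have "(\<Sum>b\<le>M. (\<Sum>a\<in>exp_box M. w (a, b) * mono_eval a (\<chi> v. f v x)) * D x ^ b) = 0" for x
  proof -
    have "(\<Sum>b\<le>M. (\<Sum>a\<in>exp_box M. w (a, b) * mono_eval a (\<chi> v. f v x)) * D x ^ b) =
        (\<Sum>b\<le>M. \<Sum>a\<in>exp_box M. w (a, b) * \<Phi> (a, b) x)"
      by (simp add: \<Phi>_def sum_distrib_right mult.assoc)
    also have "\<dots> = (\<Sum>i\<in>I. w i * \<Phi> i x)"
      unfolding I_def by (subst sum.swap) (simp add: sum.cartesian_product split_def)
    also have "\<dots> = (\<Sum>i\<in>I. \<Sum>k\<in>exp_box K. w i * c i k * mono_eval k x)"
      by (intro sum.cong) (auto simp: c sum_distrib_left mult.assoc)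
    also have "\<dots> = (\<Sum>k\<in>exp_box K. (\<Sum>i\<in>I. w i * c i k) * mono_eval k x)"
      unfolding sum_distrib_right by (rule sum.swap)
    also have "\<dots> = 0"
      using w(2) by simp
    finally show ?thesis .
  qed
  moreover have "\<exists>a\<in>exp_box M. \<exists>b\<le>M. w (a, b) \<noteq> 0"
    using w(1) by (auto simp: I_def)
  ultimately show ?thesis
    by (intro exI[of _ M] exI[of _ "\<lambda>a b. w (a, b)"]) simp
qed

lemma polyfun_mono_eval_box:
  fixes c :: "('v::finite \<Rightarrow> nat) \<Rightarrow> complex"
  shows "polyfun (CARD('v) * M) (\<lambda>w. \<Sum>a\<in>exp_box M. c a * mono_eval a w)"
proof (rule polyfun_sum)
  fix a :: "'v \<Rightarrow> nat" assume "a \<in> exp_box M"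
  then have "sum a UNIV \<le> CARD('v) * M"
    using sum_bounded_above[of UNIV a M] by (simp add: exp_box_def)
  then show "polyfun (CARD('v) * M) (\<lambda>w. c a * mono_eval a w)"
    using polyfun.mult[OF polyfun.const polyfun_mono[OF polyfun_mono_eval], of a _ 0 "c a"] by simp
qed

text \<open>A relation \<open>R(f(x), D(x)) = 0\<close> may be taken not divisible by its last variable; then
  \<open>R(w, 0)\<close> is the required hypersurface.\<close>

lemma degenerate_values_in_hypersurface:
  fixes f :: "'v::finite \<Rightarrow> complex ^ 'v \<Rightarrow> complex"
  assumes f: "\<And>v. polyfun d (f v)" and D: "polyfun d D" "D p \<noteq> 0"
  shows "\<exists>e h. polyfun e h \<and> (\<exists>w. h w \<noteq> 0) \<and> (\<forall>x. D x = 0 \<longrightarrow> h (\<chi> v. f v x) = 0)"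
proof -
  obtain M c where c: "\<exists>a\<in>exp_box M. \<exists>b\<le>M. c a b \<noteq> 0"
    and rel: "\<forall>x. (\<Sum>b\<le>M. (\<Sum>a\<in>exp_box M. c a b * mono_eval a (\<chi> v. f v x)) * D x ^ b) = 0"
    using algebraic_relation[where f = f, OF f D(1)] by - (elim exE conjE, rule that)
  define R where "R b w = (\<Sum>a\<in>exp_box M. c a b * mono_eval a w)" for b and w :: "complex ^ 'v"
  have poly: "polyfun (CARD('v) * M) (R b)" for b
    unfolding R_def by (rule polyfun_mono_eval_box)
  have "\<exists>b\<le>M. \<exists>w. R b w \<noteq> 0"
  proof -
    obtain a b where "a \<in> exp_box M" "b \<le> M" "c a b \<noteq> 0"
      using c by blast
    then show ?thesis
      using mono_eval_independent[where M = M and c = "\<lambda>a. c a b" and a = a] unfolding R_def by auto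
  qed
  then have ex: "\<exists>b. b \<le> M \<and> (\<exists>w. R b w \<noteq> 0)"
    by auto
  \<comment> \<open>\<open>b0\<close> is the largest power of the last variable that divides the
    relation; \<open>H\<close> below is the relation after division by
    \<open>D x ^ b0\<close>.\<close>
  define b0 where "b0 = (LEAST b. b \<le> M \<and> (\<exists>w. R b w \<noteq> 0))"
  have b0: "b0 \<le> M" "\<exists>w. R b0 w \<noteq> 0"
    using LeastI_ex[OF ex] unfolding b0_def[symmetric] by auto
  have below: "R b w = 0" if "b < b0" for b w
    using not_less_Least[OF that[unfolded b0_def]] that b0(1) by auto
  define H where "H x = (\<Sum>b\<in>{b0..M}. R b (\<chi> v. f v x) * D x ^ (b - b0))" for x
  have cont_f: "continuous_on S (f v)" for S v
    by (rule polyfun_continuous[OF f])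
  have "continuous_on UNIV (\<lambda>x. R b (\<chi> v. f v x))" for b
    by (rule continuous_on_compose2[OF polyfun_continuous[OF poly, of UNIV]])
      (auto intro!: continuous_intros cont_f)
  then have cont: "continuous_on UNIV H"
    unfolding H_def by (intro continuous_intros polyfun_continuous[OF D(1)])
  have DH: "D x ^ b0 * H x = 0" for x
  proof -
    have "D x ^ b0 * H x = (\<Sum>b\<in>{b0..M}. R b (\<chi> v. f v x) * D x ^ b)"
      unfolding H_def sum_distrib_left
    proof (rule sum.cong)
      fix b assume "b \<in> {b0..M}"
      then have "D x ^ b = D x ^ b0 * D x ^ (b - b0)"
        by (simp flip: power_add)
      then show "D x ^ b0 * (R b (\<chi> v. f v x) * D x ^ (b - b0)) = R b (\<chi> v. f v x) * D x ^ b"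
        by simp
    qed simp
    also have "\<dots> = (\<Sum>b\<le>M. R b (\<chi> v. f v x) * D x ^ b)"
      using below by (intro sum.mono_neutral_left) auto
    finally show ?thesis
      using rel by (simp add: R_def)
  qed
  have H0: "H x = 0" if "D x \<noteq> 0" for x
    using DH[of x] that by simp
  \<comment> \<open>The division gives this only where \<open>D x\<close> is nonzero; that set is
    dense and \<open>H\<close> is continuous.\<close>
  have "H x = 0" for x
  proof (rule ccontr)
    assume "H x \<noteq> 0"
    moreover have "open {x. H x \<noteq> 0}"
      by (rule open_Collect_neq[OF cont continuous_on_const])
    ultimately obtain y where "H y \<noteq> 0" "D y \<noteq> 0"
      using polyfun_nonzero_dense[OF D, of "{x. H x \<noteq> 0}" x] by auto
    then show False
      using H0 by blast
  qed
  moreover have "H x = R b0 (\<chi> v. f v x)" if "D x = 0" for x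
  proof -
    have "H x = (\<Sum>b\<in>{b0}. R b (\<chi> v. f v x) * D x ^ (b - b0))"
      unfolding H_def using b0(1) that by (intro sum.mono_neutral_right) (auto simp: zero_power)
    then show ?thesis
      by simp
  qed
  ultimately show ?thesis
    using poly[of b0] b0(2) by metis
qed

section \<open>Surjectivity onto a small ball\<close>

lemma has_derivative_vec_lambda:
  fixes f :: "'v::finite \<Rightarrow> 'a::real_normed_vector \<Rightarrow> 'b::euclidean_space"
  assumes "\<And>v. (f v has_derivative f' v) (at x)"
  shows "((\<lambda>x. \<chi> v. f v x) has_derivative (\<lambda>h. \<chi> v. f' v h)) (at x)"
  by (subst has_derivative_componentwise_within)
    (auto simp: Basis_vec_def inner_axis intro!: has_derivative_inner_left assms)

lemma bounded_linear_complex_matrix: "bounded_linear ((*v) (A :: complex ^ 'n::finite ^ 'm::finite))"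
  by (intro linear_conv_bounded_linear[THEN iffD1] linearI)
    (auto simp: vec_eq_iff matrix_vector_mult_def scaleR_sum_right algebra_simps sum.distrib)

text \<open>Sussmann's open mapping theorem asks for continuity and a bounded right inverse of the
  derivative at the point; the inverse matrix, acting as a real-linear map, supplies it.\<close>

lemma nondegenerate_open_at:
  fixes f :: "complex ^ 'v::finite \<Rightarrow> complex ^ 'v"
  assumes "(f has_derivative (\<lambda>h. A *v h)) (at x)" "det A \<noteq> 0"
    and "continuous_on UNIV f" "open T" "x \<in> T"
  shows "f x \<in> interior (f ` T)"
proof -
  obtain B where B: "A ** B = mat 1"
    using assms(2) invertible_det_nz[of A] unfolding invertible_def by blast
  have "(*v) A \<circ> (*v) B = id"
    by (simp add: fun_eq_iff matrix_vector_mul_assoc B)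
  then show ?thesis
    using sussmann_open_mapping[of UNIV f x "(*v) A" "(*v) B" T] assms
      bounded_linear_complex_matrix[of B]
    by (simp add: interior_open)
qed

text \<open>The bound on the sphere keeps solutions with value in the ball off the boundary. Over
  the ball minus the critical hypersurface the image is therefore closed by compactness and open by
  invertibility of the Jacobian; connectedness gives all of that set, and density the rest of the
  ball.\<close>

lemma nondegenerate_onto_ball:
  fixes f :: "'v::finite \<Rightarrow> complex ^ 'v \<Rightarrow> complex"
  assumes f: "\<And>v. polyfun d (f v)"
    and g: "\<And>u v. polyfun d (g v u)"
    and deriv: "\<And>v x. (f v has_derivative (\<lambda>h. \<Sum>u\<in>UNIV. g v u x * h $ u)) (at x)"
    and sphere: "\<And>x. x \<in> sphere z r \<Longrightarrow> \<delta> \<le> norm (\<chi> v. f v x)"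
    and p: "p \<in> ball z r" "norm (\<chi> v. f v p) < \<delta>" "det (\<chi> v u. g v u p) \<noteq> 0"
  shows "ball 0 \<delta> \<subseteq> (\<lambda>x. \<chi> v. f v x) ` cball z r"
proof -
  define F where "F x = (\<chi> v. f v x)" for x
  define D where "D x = det (\<chi> v u. g v u x)" for x
  have "polyfun (0 + (\<Sum>i\<in>(UNIV :: 'v set). d)) D"
    unfolding D_def det_def vec_lambda_beta
    by (intro polyfun_sum polyfun.mult polyfun.const polyfun_prod g)
  then have D: "polyfun (CARD('v) * d) D" "D p \<noteq> 0"
    using p(3) by (simp_all add: D_def)
  have "polyfun (CARD('v) * d) (f v)" for v
    by (rule polyfun_mono[OF f]) (simp add: Suc_leI)
  from degenerate_values_in_hypersurface[where f = f, OF this D]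
  obtain e h w where h: "polyfun e h" "h w \<noteq> 0" "\<And>x. D x = 0 \<Longrightarrow> h (F x) = 0"
    unfolding F_def by blast
  have cont: "continuous_on S F" for S
    unfolding F_def by (intro continuous_on_vec_lambda polyfun_continuous[OF f])
  have derivF: "(F has_derivative (\<lambda>h. (\<chi> v u. g v u x) *v h)) (at x)" for x
    using has_derivative_vec_lambda[OF deriv] unfolding F_def matrix_vector_mult_def vec_lambda_beta .
  have open_at: "F x \<in> interior (F ` T)" if "D x \<noteq> 0" "open T" "x \<in> T" for x T
    by (rule nondegenerate_open_at[OF derivF _ cont]) (use that in \<open>simp_all add: D_def\<close>)
  have closed: "closed (F ` cball z r)"
    by (intro compact_imp_closed compact_continuous_image cont compact_cball)
  define G where "G = {w \<in> ball 0 \<delta>. h w \<noteq> 0}"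
  have "connected G"
    unfolding G_def by (rule polyfun_nonzero_connected[OF h(1)]) auto
  have "G \<inter> F ` cball z r = G \<inter> interior (F ` ball z r)"
  proof safe
    fix x assume x: "x \<in> cball z r" "F x \<in> G"
    then have "x \<notin> sphere z r"
      using sphere[of x] by (auto simp: G_def F_def)
    then have "x \<in> ball z r"
      using x(1) by auto
    moreover have "D x \<noteq> 0"
      using x(2) h(3)[of x] by (auto simp: G_def)
    ultimately show "F x \<in> interior (F ` ball z r)"
      by (intro open_at) auto
  next
    fix y assume "y \<in> interior (F ` ball z r)"
    then have "y \<in> F ` ball z r"
      using interior_subset by blast
    then show "y \<in> F ` cball z r"
      using ball_subset_cball by blast
  qed
  moreover have "closedin (top_of_set G) (G \<inter> F ` cball z r)"
    using closed by (rule closedin_closed_Int)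
  moreover have "openin (top_of_set G) (G \<inter> interior (F ` ball z r))"
    using open_interior by (rule openin_open_Int)
  moreover have "G \<inter> interior (F ` ball z r) \<noteq> {}"
  proof -
    \<comment> \<open>\<open>F p\<close> itself may lie on the hypersurface \<open>h = 0\<close>,
      but the open set around it contains points off it.\<close>
    have "F p \<in> ball 0 \<delta> \<inter> interior (F ` ball z r)"
      using open_at[OF D(2), of "ball z r"] p by (auto simp: F_def)
    moreover have "open (ball 0 \<delta> \<inter> interior (F ` ball z r))"
      by auto
    ultimately obtain y where "y \<in> ball 0 \<delta> \<inter> interior (F ` ball z r)" "h y \<noteq> 0"
      using polyfun_nonzero_dense[OF h(1,2)] by blast
    then show ?thesis
      by (auto simp: G_def)
  qed
  ultimately have G: "G \<subseteq> F ` cball z r"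
    using \<open>connected G\<close> unfolding connected_clopen by (metis Int_lower2)
  have "ball 0 \<delta> \<subseteq> F ` cball z r"
  proof (rule ccontr)
    assume "\<not> ball 0 \<delta> \<subseteq> F ` cball z r"
    then obtain y where y: "y \<in> ball 0 \<delta> - F ` cball z r"
      by blast
    moreover have "open (ball 0 \<delta> - F ` cball z r)"
      using closed by (rule open_Diff[OF open_ball])
    ultimately obtain y' where "y' \<in> ball 0 \<delta> - F ` cball z r" "h y' \<noteq> 0"
      using polyfun_nonzero_dense[OF h(1,2)] by blast
    then show False
      using G by (auto simp: G_def)
  qed
  then show ?thesis
    by (simp add: F_def)
qed

text \<open>\<open>det (t A + I)\<close> is a polynomial in \<open>t\<close> with value 1 at
  \<open>t = 0\<close>, so it has no root of large modulus. For such \<open>t\<close>, dividing each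
  row by \<open>t\<close> leaves \<open>A\<close> plus the small scalar
  \<open>1 / t\<close>.\<close>

lemma det_add_small_scalar:
  fixes A :: "complex ^ 'v::finite ^ 'v"
  assumes "\<eta> > 0"
  shows "\<exists>\<epsilon>. norm \<epsilon> < \<eta> \<and> det (\<chi> i j. A $ i $ j + (if i = j then \<epsilon> else 0)) \<noteq> 0"
proof -
  define q where "q = (\<Sum>p | p permutes (UNIV :: 'v set). of_int (sign p) *
    (\<Prod>i\<in>UNIV. [:if i = p i then 1 else 0, A $ i $ p i:]))"
  have q: "poly q t = det (\<chi> i j. t * A $ i $ j + (if i = j then 1 else 0))" for t
    unfolding q_def det_def by (simp add: poly_sum poly_prod add.commute)
  have "poly q 0 = det (mat 1 :: complex ^ 'v ^ 'v)"
    unfolding q mat_def by simp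
  then have "q \<noteq> 0"
    by auto
  then have "bounded {t. poly q t = 0}"
    by (intro finite_imp_bounded poly_roots_finite)
  then obtain b where b: "b > 0" "\<And>t. poly q t = 0 \<Longrightarrow> norm t \<le> b"
    unfolding bounded_pos by auto
  define t :: complex where "t = of_real (b + 1 / \<eta> + 1)"
  have pos: "b + 1 / \<eta> + 1 > 0"
    using b(1) assms by (simp add: add_pos_pos)
  have "norm t = b + 1 / \<eta> + 1"
    unfolding t_def norm_of_real using pos by simp
  then have t: "norm t > b" "norm t > 1 / \<eta>"
    using b(1) assms by (auto simp: add_pos_pos)
  have t3: "t \<noteq> 0"
    using \<open>norm t = _\<close> pos by auto
  have "norm (1 / t) < \<eta>"
    using t t3 assms by (simp add: norm_divide field_simps)
  moreover have "det (\<chi> i j. A $ i $ j + (if i = j then 1 / t else 0)) \<noteq> 0"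
  proof
    assume 0: "det (\<chi> i j. A $ i $ j + (if i = j then 1 / t else 0)) = 0"
    have "poly q t = det (\<chi> i. t *s (\<chi> j. A $ i $ j + (if i = j then 1 / t else 0)))"
      unfolding q using t3
      by (intro arg_cong[of _ _ det]) (auto simp: vec_eq_iff distrib_left)
    also have "\<dots> = 0"
      using 0 unfolding det_rows_mul by simp
    finally show False
      using b(2) t(1) by fastforce
  qed
  ultimately show ?thesis
    by blast
qed

text \<open>Adding \<open>\<epsilon> *s (x - z)\<close> keeps the zero at \<open>z\<close> and can
  make the Jacobian there invertible. The perturbed map attains \<open>w\<close>, so
  \<open>F\<close> comes arbitrarily close to \<open>w\<close> on the closed ball, and compactness
  makes it attain \<open>w\<close>.\<close>

theorem isolated_zero_onto_ball:
  fixes f :: "'v::finite \<Rightarrow> complex ^ 'v \<Rightarrow> complex"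
  assumes f: "\<And>v. polyfun d (f v)" and zero: "\<And>v. f v z = 0" and r: "r > 0"
    and iso: "\<And>x. x \<in> cball z r \<Longrightarrow> (\<forall>v. f v x = 0) \<Longrightarrow> x = z"
  shows "\<exists>\<delta>>0. \<forall>w. norm w < \<delta> \<longrightarrow> (\<exists>x\<in>cball z r. \<forall>v. f v x = w $ v)"
proof -
  define F where "F x = (\<chi> v. f v x)" for x
  have cont: "continuous_on S F" for S
    unfolding F_def by (intro continuous_on_vec_lambda polyfun_continuous[OF f])
  have "closed (F ` sphere z r)"
    by (intro compact_imp_closed compact_continuous_image cont compact_sphere)
  moreover have "0 \<notin> F ` sphere z r"
    using iso r by (fastforce simp: F_def vec_eq_iff)
  ultimately obtain \<delta> where \<delta>: "\<delta> > 0" "\<And>x. x \<in> sphere z r \<Longrightarrow> \<delta> \<le> norm (F x)"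
    using separate_point_closed[of "F ` sphere z r" 0] by auto
  obtain g where g: "\<And>u v. polyfun d (g v u)"
      "\<And>v x. (f v has_derivative (\<lambda>h. \<Sum>u\<in>UNIV. g v u x * h $ u)) (at x)"
    using polyfun_has_derivative[OF f] by metis
  \<comment> \<open>Half of \<open>\<delta>\<close> is reserved for the perturbation, so one radius
    serves every \<open>\<epsilon>\<close>.\<close>
  have "w \<in> F ` cball z r" if w: "norm w < \<delta> / 2" for w
  proof -
    have "\<exists>y\<in>F ` cball z r. dist y w < \<eta>" if "\<eta> > 0" for \<eta>
    proof -
      obtain \<epsilon> where \<epsilon>: "norm \<epsilon> < min \<eta> (\<delta> / 2) / r"
        "det (\<chi> v u. g v u z + (if v = u then \<epsilon> else 0)) \<noteq> 0"
        using det_add_small_scalar[of "min \<eta> (\<delta> / 2) / r" "\<chi> v u. g v u z"] \<delta>(1) r \<open>\<eta> > 0\<close> by auto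
      define f' where "f' v x = f v x + \<epsilon> * (x $ v - z $ v)" for v x
      define g' where "g' v u x = g v u x + (if v = u then \<epsilon> else 0)" for v u x
      have eq: "(\<chi> v. f' v x) = F x + \<epsilon> *s (x - z)" for x
        by (simp add: f'_def F_def vec_eq_iff algebra_simps)
      have norm_smult: "norm (\<epsilon> *s y) = norm \<epsilon> * norm y" for y :: "complex ^ 'v"
        by (simp add: norm_vec_def norm_mult L2_set_right_distrib)
      have small: "norm (\<epsilon> *s (x - z)) < min \<eta> (\<delta> / 2)" if "x \<in> cball z r" for x
      proof -
        have "norm (\<epsilon> *s (x - z)) \<le> norm \<epsilon> * r"
          unfolding norm_smult using that by (intro mult_left_mono) (auto simp: dist_norm norm_minus_commute)
        also have "\<dots> < min \<eta> (\<delta> / 2)"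
          using \<epsilon>(1) r by (simp add: pos_less_divide_eq)
        finally show ?thesis .
      qed
      have "polyfun (Suc d) (f' v)" for v
      proof -
        have "polyfun (0 + Suc d) (\<lambda>x. \<epsilon> * (x $ v + (- (z $ v))))"
          by (intro polyfun.mult polyfun.add polyfun.const polyfun.var)
        then show ?thesis
          unfolding f'_def using polyfun.add[OF polyfun_mono[OF f]] by simp
      qed
      moreover have "polyfun (Suc d) (g' v u)" for v u
        unfolding g'_def by (intro polyfun.add polyfun.const polyfun_mono[OF g(1)]) simp
      moreover have "(f' v has_derivative (\<lambda>h. \<Sum>u\<in>UNIV. g' v u x * h $ u)) (at x)" for v x
      proof -
        have "((\<lambda>x. \<epsilon> * (x $ v - z $ v)) has_derivative (\<lambda>h. \<epsilon> * h $ v)) (at x)"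
          by (auto intro!: derivative_eq_intros bounded_linear_imp_has_derivative bounded_linear_vec_nth)
        moreover have "(\<Sum>u\<in>UNIV. g' v u x * h $ u) = (\<Sum>u\<in>UNIV. g v u x * h $ u) + \<epsilon> * h $ v" for h
        proof -
          have "(\<Sum>u\<in>UNIV. (if v = u then \<epsilon> else 0) * h $ u) = (\<Sum>u\<in>UNIV. if v = u then \<epsilon> * h $ u else 0)"
            by (intro sum.cong) auto
          then show ?thesis
            by (simp add: g'_def distrib_right sum.distrib)
        qed
        ultimately show ?thesis
          unfolding f'_def using has_derivative_add[OF g(2)] by simp
      qed
      moreover have "\<delta> / 2 \<le> norm (\<chi> v. f' v x)" if "x \<in> sphere z r" for x
        using \<delta>(2)[OF that] small[of x] that norm_diff_ineq[of "F x" "\<epsilon> *s (x - z)"] unfolding eq by auto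
      moreover have "F z = 0"
        by (simp add: F_def zero vec_eq_iff)
      then have "norm (\<chi> v. f' v z) < \<delta> / 2"
        unfolding eq using \<delta>(1) by simp
      moreover have "det (\<chi> v u. g' v u z) \<noteq> 0"
        using \<epsilon>(2) by (simp add: g'_def)
      ultimately have "ball 0 (\<delta> / 2) \<subseteq> (\<lambda>x. \<chi> v. f' v x) ` cball z r"
        using r by (intro nondegenerate_onto_ball[where p = z]) auto
      then obtain x where x: "x \<in> cball z r" "w = F x + \<epsilon> *s (x - z)"
        using w unfolding eq by auto
      have "dist y (y + y') = norm y'" for y y' :: "complex ^ 'v"
        by (simp add: dist_norm)
      then have "dist (F x) w < \<eta>"
        using small[OF x(1)] unfolding x(2) by (simp only: min_less_iff_conj)
      then show ?thesis
        using x(1) by blast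
    qed
    then have "w \<in> closure (F ` cball z r)"
      unfolding closure_approachable by blast
    moreover have "closed (F ` cball z r)"
      by (intro compact_imp_closed compact_continuous_image cont compact_cball)
    ultimately show ?thesis
      by simp
  qed
  then show ?thesis
    using \<delta>(1) by (intro exI[of _ "\<delta> / 2"]) (fastforce simp: F_def)
qed

section \<open>Counting exponents and Siegel's lemma\<close>

definition exps :: "'v set \<Rightarrow> nat \<Rightarrow> ('v \<Rightarrow> nat) set" where
  "exps V k = {a. (\<forall>v. v \<notin> V \<longrightarrow> a v = 0) \<and> sum a V \<le> k}"

text \<open>\<open>P\<close>, \<open>Q\<close>, \<open>W\<close> will be the variables of \<open>X\<close>, \<open>S\<close>, \<open>y\<close>: bounding both mixed degrees by \<open>k\<close>
  saves the factor needed over the count of all monomials of degree at most \<open>2k\<close>.\<close>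

definition biexps :: "'v set \<Rightarrow> 'v set \<Rightarrow> 'v set \<Rightarrow> nat \<Rightarrow> ('v \<Rightarrow> nat) set" where
  "biexps P Q W k = {a. (\<forall>v. v \<notin> P \<union> Q \<union> W \<longrightarrow> a v = 0) \<and>
     sum a P + sum a W \<le> k \<and> sum a Q + sum a W \<le> k}"

text \<open>The hockey-stick identity, summed over the degree \<open>j\<close> given to one extra
  variable.\<close>

lemma sum_choose_shift: "(\<Sum>j\<le>k. (k - j + n) choose n) = (Suc k + n) choose Suc n"
proof -
  have "(\<Sum>j\<le>k. (k - j + n) choose n) = (\<Sum>i\<le>k. (i + n) choose n)"
    by (rule sum.reindex_bij_witness[of _ "\<lambda>i. k - i" "\<lambda>j. k - j"]) auto
  also have "\<dots> = (Suc k + n) choose Suc n"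
    by (induction k) auto
  finally show ?thesis .
qed

lemma exps_finite_card:
  fixes V :: "'v set"
  assumes "finite V"
  shows "finite (exps V k) \<and> card (exps V k) = (k + card V) choose card V"
  using assms
proof (induction V arbitrary: k rule: finite_induct)
  case empty
  have "exps ({} :: 'v set) k = {\<lambda>_. 0}" for k
    by (auto simp: exps_def)
  then show ?case
    by simp
next
  case (insert u V)
  let ?S = "SIGMA j:{..k}. exps V (k - j)"
  have bij: "bij_betw (\<lambda>(j, a). a(u := j)) ?S (exps (insert u V) k)"
  proof (rule bij_betw_byWitness[where f' = "\<lambda>a. (a u, a(u := 0))"])
    have sum: "(\<Sum>v\<in>V. if v = u then j else a v) = sum a V" for a and j :: nat
      using insert.hyps(2) by (intro sum.cong) auto
    show "(\<lambda>(j, a). a(u := j)) ` ?S \<subseteq> exps (insert u V) k"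
      using insert.hyps by (auto simp: exps_def sum)
    show "(\<lambda>a. (a u, a(u := 0))) ` exps (insert u V) k \<subseteq> ?S"
      using insert.hyps by (auto simp: exps_def sum)
  qed (use insert.hyps(2) in \<open>auto simp: exps_def fun_eq_iff\<close>)
  have "finite ?S"
    using insert.IH by auto
  then have "finite (exps (insert u V) k)"
    using bij_betw_finite[OF bij] by blast
  moreover have "card ?S = (\<Sum>j\<le>k. (k - j + card V) choose card V)"
    using insert.IH by (simp add: card_SigmaI)
  then have "card (exps (insert u V) k) = (Suc k + card V) choose Suc (card V)"
    using bij_betw_same_card[OF bij] sum_choose_shift[of k "card V"] by simp
  ultimately show ?case
    using insert.hyps by simp
qed

lemmas finite_exps = exps_finite_card[THEN conjunct1]
lemmas card_exps = exps_finite_card[THEN conjunct2]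

lemma exps_split:
  assumes "finite V" "finite W" "V \<inter> W = {}"
  shows "card (exps (V \<union> W) k) = (\<Sum>c\<in>exps W k. card (exps V (k - sum c W)))"
proof -
  let ?S = "SIGMA c:exps W k. exps V (k - sum c W)"
  have bij: "bij_betw (\<lambda>(c, a) v. a v + c v) ?S (exps (V \<union> W) k)"
  proof (rule bij_betw_byWitness[where f' = "\<lambda>a. (\<lambda>v. if v \<in> W then a v else 0, \<lambda>v. if v \<in> V then a v else 0)"])
    have V: "(\<Sum>v\<in>V. a v + c v) = sum a V" "(\<Sum>v\<in>W. a v + c v) = sum c W"
      if "\<forall>v. v \<notin> W \<longrightarrow> c v = 0" "\<forall>v. v \<notin> V \<longrightarrow> a v = 0" for a c :: "'a \<Rightarrow> nat"
      using that assms(3) by (auto intro!: sum.cong)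
    show "(\<lambda>(c, a) v. a v + c v) ` ?S \<subseteq> exps (V \<union> W) k"
      using assms by (auto simp: exps_def sum.union_disjoint V)
    show "(\<lambda>a. (\<lambda>v. if v \<in> W then a v else 0, \<lambda>v. if v \<in> V then a v else 0)) ` exps (V \<union> W) k \<subseteq> ?S"
      using assms by (auto simp: exps_def sum.union_disjoint)
  qed (use assms(3) in \<open>auto simp: exps_def fun_eq_iff\<close>)
  show ?thesis
    using bij_betw_same_card[OF bij] assms by (simp add: card_SigmaI finite_exps)
qed

text \<open>Once the \<open>W\<close>-part \<open>c\<close> is fixed, the two degree bounds
  constrain the \<open>P\<close>-part and the \<open>Q\<close>-part independently.\<close>

lemma biexps_split:
  assumes "finite P" "finite Q" "finite W" "P \<inter> Q = {}" "P \<inter> W = {}" "Q \<inter> W = {}"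
  shows "finite (biexps P Q W k)"
    and "card (biexps P Q W k) =
      (\<Sum>c\<in>exps W k. card (exps P (k - sum c W)) * card (exps Q (k - sum c W)))"
proof -
  let ?S = "SIGMA c:exps W k. exps P (k - sum c W) \<times> exps Q (k - sum c W)"
  have bij: "bij_betw (\<lambda>(c, a, b) v. a v + b v + c v) ?S (biexps P Q W k)"
  proof (rule bij_betw_byWitness[where f' = "\<lambda>a. (\<lambda>v. if v \<in> W then a v else 0,
        \<lambda>v. if v \<in> P then a v else 0, \<lambda>v. if v \<in> Q then a v else 0)"])
    have V: "(\<Sum>v\<in>P. a v + b v + c v) = sum a P" "(\<Sum>v\<in>Q. a v + b v + c v) = sum b Q"
      "(\<Sum>v\<in>W. a v + b v + c v) = sum c W"
      if "\<forall>v. v \<notin> W \<longrightarrow> c v = 0" "\<forall>v. v \<notin> P \<longrightarrow> a v = 0" "\<forall>v. v \<notin> Q \<longrightarrow> b v = 0"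
      for a b c :: "'a \<Rightarrow> nat"
      using that assms(4-6) by (auto intro!: sum.cong simp: disjoint_iff) blast+
    show "(\<lambda>(c, a, b) v. a v + b v + c v) ` ?S \<subseteq> biexps P Q W k"
      by (auto simp: exps_def biexps_def V)
    show "(\<lambda>a. (\<lambda>v. if v \<in> W then a v else 0, \<lambda>v. if v \<in> P then a v else 0,
        \<lambda>v. if v \<in> Q then a v else 0)) ` biexps P Q W k \<subseteq> ?S"
      by (auto simp: exps_def biexps_def)
  qed (use assms(4-6) in \<open>auto simp: exps_def biexps_def fun_eq_iff\<close>)
  have fin: "finite ?S"
    using assms by (auto simp: finite_exps)
  show "finite (biexps P Q W k)"
    using fin bij_betw_finite[OF bij] by blast
  show "card (biexps P Q W k) =
      (\<Sum>c\<in>exps W k. card (exps P (k - sum c W)) * card (exps Q (k - sum c W)))"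
    using bij_betw_same_card[OF bij] assms by (simp add: card_SigmaI finite_exps card_cartesian_product)
qed

text \<open>Log-convexity of the factorial; the induction step compares \<open>(k + a + 1)^2\<close>
  with \<open>(k + 2 * a + 1) * (k + 2 * a + 2)\<close>.\<close>

lemma fact_square_le: "(fact (k + a))\<^sup>2 \<le> (fact k * fact (k + 2 * a) :: nat)"
proof (induction a)
  case (Suc a)
  have "(fact (k + Suc a))\<^sup>2 = (Suc (k + a))\<^sup>2 * (fact (k + a))\<^sup>2"
    by (simp add: power2_eq_square algebra_simps)
  also have "\<dots> \<le> (Suc (k + 2 * a) * Suc (Suc (k + 2 * a))) * (fact k * fact (k + 2 * a))"
    by (intro mult_mono Suc.IH) (unfold power2_eq_square, intro mult_mono, simp_all)
  also have "\<dots> = fact k * fact (k + 2 * Suc a)"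
    by (simp add: algebra_simps)
  finally show ?case .
qed (simp add: power2_eq_square)

text \<open>Two separate simplices in \<open>a\<close> variables are traded for one in
  \<open>2 * a\<close> variables at the cost of a factor free of \<open>k\<close>. Multiplied out
  with factorials this is log-convexity.\<close>

lemma choose_square_le:
  "((k + a) choose a)\<^sup>2 \<le> ((2 * a) choose a) * ((k + 2 * a) choose (2 * a))"
proof -
  define x where "x = (k + a) choose a"
  define y where "y = (2 * a) choose a"
  define z where "z = (k + 2 * a) choose (2 * a)"
  have x: "fact k * fact a * x = fact (k + a)"
    using binomial_fact_lemma[of a "k + a"] by (simp add: x_def mult_ac)
  have y: "fact a * fact a * y = fact (2 * a)"
    using binomial_fact_lemma[of a "2 * a"] by (simp add: y_def mult_2)
  have z: "fact k * fact (2 * a) * z = fact (k + 2 * a)"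
    using binomial_fact_lemma[of "2 * a" "k + 2 * a"] by (simp add: z_def mult_ac)
  have "(fact k * fact a)\<^sup>2 * x\<^sup>2 = (fact (k + a))\<^sup>2"
    using x by (simp flip: power_mult_distrib)
  also have "\<dots> \<le> fact k * fact (k + 2 * a)"
    by (rule fact_square_le)
  also have "\<dots> = fact k * (fact k * (fact a * fact a * y) * z)"
    unfolding y z ..
  also have "\<dots> = (fact k * fact a)\<^sup>2 * (y * z)"
    by (simp add: power2_eq_square mult_ac)
  finally show ?thesis
    by (simp add: x_def y_def z_def)
qed

text \<open>The central coefficient is the sum of two adjacent entries of row
  \<open>2 * a - 1\<close>, hence at most that row sum. The factor 2 gained here is what later
  permits \<open>2 ^ (N - 2)\<close>.\<close>

lemma central_binomial_le:
  assumes "a > 0"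
  shows "2 * ((2 * a) choose a) \<le> 2 ^ (2 * a)"
proof -
  obtain a' where a: "a = Suc a'"
    using assms by (cases a) auto
  have "(2 * a) choose a = (Suc (2 * a') choose a') + (Suc (2 * a') choose Suc a')"
    unfolding a by simp
  also have "\<dots> = (\<Sum>i\<in>{a', Suc a'}. Suc (2 * a') choose i)"
    by simp
  also have "\<dots> \<le> (\<Sum>i\<le>Suc (2 * a'). Suc (2 * a') choose i)"
    by (intro sum_mono2) auto
  also have "\<dots> = 2 ^ Suc (2 * a')"
    by (rule choose_row_sum)
  finally show ?thesis
    by (simp add: a)
qed

lemma card_biexps_le:
  assumes "finite P" "finite Q" "finite W" "P \<inter> Q = {}" "P \<inter> W = {}" "Q \<inter> W = {}"
    and "card P = a" "card Q = a"
  shows "card (biexps P Q W k) \<le>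
    ((2 * a) choose a) * ((k + (2 * a + card W)) choose (2 * a + card W))"
proof -
  have PQ: "card (P \<union> Q) = 2 * a" "(P \<union> Q) \<inter> W = {}" "finite (P \<union> Q)"
    using assms by (auto simp: card_Un_disjoint)
  have "card (biexps P Q W k) = (\<Sum>c\<in>exps W k. (((k - sum c W) + a) choose a)\<^sup>2)"
    using biexps_split(2)[OF assms(1-6)] assms by (simp add: card_exps power2_eq_square)
  also have "\<dots> \<le> (\<Sum>c\<in>exps W k. ((2 * a) choose a) * card (exps (P \<union> Q) (k - sum c W)))"
    using PQ by (intro sum_mono) (simp add: card_exps choose_square_le)
  also have "\<dots> = ((2 * a) choose a) * card (exps (P \<union> Q \<union> W) k)"
    using exps_split[OF PQ(3) assms(3) PQ(2)] by (simp add: sum_distrib_left)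
  also have "card (exps (P \<union> Q \<union> W) k) = (k + (2 * a + card W)) choose (2 * a + card W)"
    using card_exps[of "P \<union> Q \<union> W" k] PQ assms(3) by (simp add: card_Un_disjoint)
  finally show ?thesis .
qed

section \<open>Siegel's lemma and bounds for roots of integer polynomials\<close>

text \<open>Pigeonhole: there are more vectors with entries in \<open>{0..h}\<close> than possible
  values of the linear forms, so two vectors have equal values, and their difference is the
  solution.\<close>

lemma siegel_lemma:
  fixes A :: "'i \<Rightarrow> 'r \<Rightarrow> int"
  assumes fin: "finite I" "finite R"
    and bound: "\<And>r. r \<in> R \<Longrightarrow> (\<Sum>i\<in>I. \<bar>A i r\<bar>) \<le> int S"
    and card: "Suc (h * S) ^ card R < Suc h ^ card I"
  shows "\<exists>w :: 'i \<Rightarrow> int. (\<exists>i\<in>I. w i \<noteq> 0) \<and> (\<forall>i\<in>I. \<bar>w i\<bar> \<le> int h) \<and>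
    (\<forall>r\<in>R. (\<Sum>i\<in>I. w i * A i r) = 0)"
proof -
  define X where "X = (\<Pi>\<^sub>E i\<in>I. {0..int h})"
  \<comment> \<open>Separating the signs of the entries gives each form a range of length
    \<open>h\<close> times the sum of the absolute entries, half the length of the symmetric
    range.\<close>
  define lo where "lo r = int h * (\<Sum>i\<in>I. min 0 (A i r))" for r
  define hi where "hi r = int h * (\<Sum>i\<in>I. max 0 (A i r))" for r
  define Y where "Y = (\<Pi>\<^sub>E r\<in>R. {lo r..hi r})"
  define \<Phi> where "\<Phi> w = restrict (\<lambda>r. \<Sum>i\<in>I. w i * A i r) R" for w :: "'i \<Rightarrow> int"
  have "\<Phi> w \<in> Y" if w: "w \<in> X" for w
  proof -
    have w: "0 \<le> w i \<and> w i \<le> int h" if "i \<in> I" for i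
      using w that by (auto simp: X_def PiE_iff)
    have "lo r \<le> (\<Sum>i\<in>I. w i * A i r)" for r
      unfolding lo_def sum_distrib_left
    proof (rule sum_mono)
      fix i assume "i \<in> I"
      from w[OF this] show "int h * min 0 (A i r) \<le> w i * A i r"
        by (cases "A i r \<ge> 0") (auto simp: min_def intro: mult_right_mono_neg)
    qed
    moreover have "(\<Sum>i\<in>I. w i * A i r) \<le> hi r" for r
      unfolding hi_def sum_distrib_left
    proof (rule sum_mono)
      fix i assume "i \<in> I"
      from w[OF this] show "w i * A i r \<le> int h * max 0 (A i r)"
        by (cases "A i r \<ge> 0") (auto simp: max_def intro: mult_right_mono mult_nonneg_nonpos)
    qed
    ultimately show ?thesis
      by (auto simp: Y_def \<Phi>_def)
  qed
  moreover have "card Y < card X"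
  proof -
    have diff: "hi r - lo r \<le> int (h * S)" if "r \<in> R" for r
    proof -
      have "hi r - lo r = int h * (\<Sum>i\<in>I. \<bar>A i r\<bar>)"
        unfolding hi_def lo_def right_diff_distrib[symmetric] sum_subtractf[symmetric]
        by (intro arg_cong2[of _ _ _ _ "(*)"] sum.cong) auto
      then show ?thesis
        using mult_left_mono[OF bound[OF that], of "int h"] by simp
    qed
    have "nat (hi r - lo r + 1) \<le> Suc (h * S)" if "r \<in> R" for r
      using diff[OF that] by linarith
    then have "card Y \<le> (\<Prod>r\<in>R. Suc (h * S))"
      unfolding Y_def card_PiE[OF fin(2)] by (intro prod_mono) auto
    also have "\<dots> < card X"
    proof -
      have "nat (int h + 1) = Suc h"
        by simp
      then show ?thesis
        using card by (simp add: X_def card_PiE fin(1) )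
    qed
    finally show ?thesis .
  qed
  moreover have "finite Y"
    by (auto simp: Y_def intro: finite_PiE fin)
  ultimately have "\<not> inj_on \<Phi> X"
    using card_inj_on_le[of \<Phi> X Y] by force
  then obtain w w' where ww: "w \<in> X" "w' \<in> X" "\<Phi> w = \<Phi> w'" "w \<noteq> w'"
    unfolding inj_on_def by blast
  then have "\<exists>i\<in>I. w i - w' i \<noteq> 0"
    unfolding X_def by (metis PiE_ext eq_iff_diff_eq_0)
  moreover have "\<bar>w i - w' i\<bar> \<le> int h" if "i \<in> I" for i
    using ww(1,2) that by (force simp: X_def PiE_iff)
  moreover have "(\<Sum>i\<in>I. (w i - w' i) * A i r) = 0" if "r \<in> R" for r
    using fun_cong[OF ww(3), of r] that by (simp add: \<Phi>_def left_diff_distrib sum_subtractf)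
  ultimately show ?thesis
    by (intro exI[of _ "\<lambda>i. w i - w' i"]) auto
qed

text \<open>Cauchy's bound: a nonzero integer leading coefficient has modulus at least 1, so for
  larger \<open>t\<close> the leading term exceeds the geometric sum that bounds the others. Since
  \<open>c M\<close> may vanish, the true degree \<open>B\<close> is used.\<close>

lemma integer_root_upper_bound:
  fixes c :: "nat \<Rightarrow> int" and t :: complex
  assumes nz: "\<exists>b\<le>M. c b \<noteq> 0" and h: "\<And>b. b \<le> M \<Longrightarrow> \<bar>c b\<bar> \<le> int h"
    and root: "(\<Sum>b\<le>M. of_int (c b) * t ^ b) = 0"
  shows "norm t \<le> real h + 1"
proof (rule ccontr)
  assume "\<not> norm t \<le> real h + 1"
  then have t: "norm t - 1 > real h" "norm t > 1"
    by auto
  define B where "B = Max {b. b \<le> M \<and> c b \<noteq> 0}"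
  have fin: "finite {b. b \<le> M \<and> c b \<noteq> 0}"
    by simp
  have B: "B \<le> M" "c B \<noteq> 0"
    using Max_in[OF fin] nz unfolding B_def by auto
  have above: "c b = 0" if "b \<le> M" "B < b" for b
    using Max_ge[OF fin, of b] that unfolding B_def by fastforce
  have "(\<Sum>b\<le>M. of_int (c b) * t ^ b) = (\<Sum>b\<le>B. of_int (c b) * t ^ b)"
    using B above by (intro sum.mono_neutral_right) (auto simp: not_le)
  then have "of_int (c B) * t ^ B = - (\<Sum>b<B. of_int (c b) * t ^ b)"
    using root by (simp add: lessThan_Suc_atMost[symmetric] add_eq_0_iff)
  then have eq: "norm (of_int (c B) * t ^ B) = norm (\<Sum>b<B. of_int (c b) * t ^ b)"
    by (simp only: norm_minus_cancel)
  have "norm t ^ B \<le> norm (of_int (c B) * t ^ B)"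
  proof -
    have "1 \<le> \<bar>real_of_int (c B)\<bar>"
      using B(2) by linarith
    then show ?thesis
      using mult_right_mono[of 1 "\<bar>real_of_int (c B)\<bar>" "norm t ^ B"] by (simp add: norm_mult norm_power)
  qed
  also have "\<dots> \<le> (\<Sum>b<B. norm (of_int (c b) * t ^ b))"
    unfolding eq by (rule norm_sum)
  also have "\<dots> \<le> (\<Sum>b<B. real h * norm t ^ b)"
  proof (rule sum_mono)
    fix b assume "b \<in> {..<B}"
    then have "\<bar>c b\<bar> \<le> int h"
      using h B(1) by simp
    then have "\<bar>real_of_int (c b)\<bar> \<le> real h"
      by linarith
    then show "norm (of_int (c b) * t ^ b) \<le> real h * norm t ^ b"
      by (simp add: norm_mult norm_power mult_right_mono)
  qed
  also have "\<dots> = real h * ((norm t ^ B - 1) / (norm t - 1))"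
    using t(2) by (simp add: sum_distrib_left[symmetric] geometric_sum)
  also have "\<dots> \<le> norm t ^ B - 1"
  proof -
    have "norm t ^ B - 1 \<ge> 0"
      using t(2) by simp
    then have "real h * (norm t ^ B - 1) \<le> (norm t - 1) * (norm t ^ B - 1)"
      using t(1) by (intro mult_right_mono) auto
    then show ?thesis
      using t(2) by (simp add: pos_divide_le_eq mult.commute)
  qed
  finally show False
    by simp
qed

text \<open>Reversing the coefficients makes \<open>inverse t\<close> a root of a polynomial of the
  same height.\<close>

lemma integer_root_lower_bound:
  fixes c :: "nat \<Rightarrow> int" and t :: complex
  assumes nz: "\<exists>b\<le>M. c b \<noteq> 0" and h: "\<And>b. b \<le> M \<Longrightarrow> \<bar>c b\<bar> \<le> int h"
    and root: "(\<Sum>b\<le>M. of_int (c b) * t ^ b) = 0" and t: "t \<noteq> 0"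
  shows "1 / (real h + 1) \<le> norm t"
proof -
  have "(\<Sum>b\<le>M. of_int (c (M - b)) * inverse t ^ b) = 0"
  proof -
    have "(\<Sum>b\<le>M. of_int (c (M - b)) * inverse t ^ b) =
        (\<Sum>b\<le>M. of_int (c b) * inverse t ^ (M - b))"
      by (rule sum.reindex_bij_witness[of _ "\<lambda>b. M - b" "\<lambda>b. M - b"]) auto
    also have "\<dots> = (\<Sum>b\<le>M. inverse t ^ M * (of_int (c b) * t ^ b))"
    proof (rule sum.cong)
      fix b assume "b \<in> {..M}"
      then have "inverse t ^ M = inverse t ^ (M - b) * inverse t ^ b"
        by (simp flip: power_add)
      then show "of_int (c b) * inverse t ^ (M - b) = inverse t ^ M * (of_int (c b) * t ^ b)"
        using t by (simp add: field_simps)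
    qed simp
    also have "\<dots> = 0"
      using root by (simp flip: sum_distrib_left)
    finally show ?thesis .
  qed
  moreover have "\<exists>b\<le>M. c (M - b) \<noteq> 0"
    using nz by (metis diff_diff_cancel diff_le_self)
  ultimately have "norm (inverse t) \<le> real h + 1"
    using h by (intro integer_root_upper_bound[of M "\<lambda>b. c (M - b)"]) auto
  then have "inverse (norm t) \<le> real h + 1"
    by (simp add: norm_inverse)
  then have "1 \<le> (real h + 1) * norm t"
    using t by (simp add: inverse_eq_divide pos_divide_le_eq)
  then show ?thesis
    by (simp add: pos_divide_le_eq add_pos_nonneg mult.commute)
qed

section \<open>Integer relations of small height\<close>

lemma sum_abs_convolution_le:
  fixes c d :: "('v \<Rightarrow> nat) \<Rightarrow> int"
  assumes "finite P" "finite Q" "finite R" "\<And>a b. a \<in> P \<Longrightarrow> b \<in> Q \<Longrightarrow> (\<lambda>v. a v + b v) \<in> R"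
  shows "(\<Sum>k\<in>R. \<bar>convolution P Q c d k\<bar>) \<le> (\<Sum>a\<in>P. \<bar>c a\<bar>) * (\<Sum>b\<in>Q. \<bar>d b\<bar>)"
proof -
  have "(\<Sum>k\<in>R. \<bar>convolution P Q c d k\<bar>) \<le>
      (\<Sum>k\<in>R. \<Sum>(a, b)\<in>{p \<in> P \<times> Q. (\<lambda>(a, b) v. a v + b v) p = k}. \<bar>c a\<bar> * \<bar>d b\<bar>)"
  proof (rule sum_mono)
    fix k
    have "\<bar>convolution P Q c d k\<bar> \<le> (\<Sum>p\<in>{(a, b)\<in>P \<times> Q. (\<lambda>v. a v + b v) = k}. \<bar>case p of (a, b) \<Rightarrow> c a * d b\<bar>)"
      unfolding convolution_def by (rule sum_abs)
    also have "\<dots> = (\<Sum>(a, b)\<in>{p \<in> P \<times> Q. (\<lambda>(a, b) v. a v + b v) p = k}. \<bar>c a\<bar> * \<bar>d b\<bar>)"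
      by (intro sum.cong) (auto simp: abs_mult)
    finally show "\<bar>convolution P Q c d k\<bar> \<le> \<dots>" .
  qed
  also have "\<dots> = (\<Sum>(a, b)\<in>P \<times> Q. \<bar>c a\<bar> * \<bar>d b\<bar>)"
    using assms by (intro sum.group) auto
  also have "\<dots> = (\<Sum>a\<in>P. \<bar>c a\<bar>) * (\<Sum>b\<in>Q. \<bar>d b\<bar>)"
    by (simp add: sum_product sum.cartesian_product)
  finally show ?thesis .
qed

text \<open>\<open>R j\<close> holds the exponents allowed at level \<open>j\<close>. Levels add
  under multiplication as degrees do, but can be adapted to the shape of the system;
  \<open>G\<close> is the growth of the coefficients per level.\<close>

locale exponent_filtration =
  fixes R :: "nat \<Rightarrow> ('v::finite \<Rightarrow> nat) set" and G :: nat
  assumes finite_R: "finite (R j)"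
    and zero_R: "(\<lambda>_. 0) \<in> R j"
    and add_R: "a \<in> R i \<Longrightarrow> b \<in> R j \<Longrightarrow> (\<lambda>v. a v + b v) \<in> R (i + j)"
    and G_pos: "G \<ge> 1"
begin

text \<open>The sum of absolute coefficients is submultiplicative under convolution, so the bound
  \<open>G ^ j\<close> passes to products without a factor for the number of monomials.\<close>

definition integral_expansion :: "nat \<Rightarrow> (complex ^ 'v \<Rightarrow> complex) \<Rightarrow> bool" where
  "integral_expansion j f \<longleftrightarrow> (\<exists>c :: ('v \<Rightarrow> nat) \<Rightarrow> int.
     (\<forall>x. f x = (\<Sum>a\<in>R j. of_int (c a) * mono_eval a x)) \<and> (\<Sum>a\<in>R j. \<bar>c a\<bar>) \<le> int G ^ j)"

lemma integral_expansion_one: "integral_expansion j (\<lambda>_. 1)"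
proof -
  define c :: "('v \<Rightarrow> nat) \<Rightarrow> int" where "c a = (if a = (\<lambda>_. 0) then 1 else 0)" for a
  have "1 = (\<Sum>a\<in>R j. of_int (c a) * mono_eval a x)" for x
    using sum_mono_eval_delta[OF finite_R zero_R, where c = 1 and x = x] by (simp add: c_def if_distrib cong: if_cong)
  moreover have "(\<Sum>a\<in>R j. \<bar>c a\<bar>) = 1"
    unfolding c_def using finite_R zero_R by (simp add: if_distrib cong: if_cong)
  moreover have "1 \<le> int G ^ j"
    using G_pos by (simp add: one_le_power)
  ultimately show ?thesis
    unfolding integral_expansion_def by (intro exI[of _ c]) simp
qed

lemma integral_expansion_mult:
  assumes "integral_expansion i f" "integral_expansion j g"
  shows "integral_expansion (i + j) (\<lambda>x. f x * g x)"
proof -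
  obtain c where c: "\<And>x. f x = (\<Sum>a\<in>R i. of_int (c a) * mono_eval a x)" "(\<Sum>a\<in>R i. \<bar>c a\<bar>) \<le> int G ^ i"
    using assms(1) unfolding integral_expansion_def by blast
  obtain d where d: "\<And>x. g x = (\<Sum>a\<in>R j. of_int (d a) * mono_eval a x)" "(\<Sum>a\<in>R j. \<bar>d a\<bar>) \<le> int G ^ j"
    using assms(2) unfolding integral_expansion_def by blast
  let ?e = "convolution (R i) (R j) c d"
  have "convolution (R i) (R j) (\<lambda>a. of_int (c a)) (\<lambda>a. of_int (d a)) k = (of_int (?e k) :: complex)" for k
    by (simp add: convolution_def split_def)
  then have "f x * g x = (\<Sum>k\<in>R (i + j). of_int (?e k) * mono_eval k x)" for x
    unfolding c(1) d(1) using convolution_mono_eval[OF finite_R finite_R finite_R add_R] by simp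
  moreover have "(\<Sum>k\<in>R (i + j). \<bar>?e k\<bar>) \<le> int G ^ (i + j)"
  proof -
    have "(\<Sum>k\<in>R (i + j). \<bar>?e k\<bar>) \<le> (\<Sum>a\<in>R i. \<bar>c a\<bar>) * (\<Sum>b\<in>R j. \<bar>d b\<bar>)"
      by (rule sum_abs_convolution_le[OF finite_R finite_R finite_R add_R])
    also have "\<dots> \<le> int G ^ i * int G ^ j"
      by (intro mult_mono c d) (auto intro: sum_nonneg)
    finally show ?thesis
      by (simp add: power_add)
  qed
  ultimately show ?thesis
    unfolding integral_expansion_def by (intro exI[of _ ?e]) simp
qed

lemma integral_expansion_mono:
  assumes "integral_expansion i f" "i \<le> j"
  shows "integral_expansion j f"
  using integral_expansion_mult[OF assms(1) integral_expansion_one[of "j - i"]] assms(2) by simp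

lemma integral_expansion_power:
  assumes "integral_expansion 1 f"
  shows "integral_expansion n (\<lambda>x. f x ^ n)"
proof (induction n)
  case (Suc n)
  then show ?case
    using integral_expansion_mult[OF assms] by simp
qed (simp add: integral_expansion_one)

lemma integral_expansion_prod:
  assumes "\<And>v. v \<in> V \<Longrightarrow> integral_expansion (d v) (f v)"
  shows "integral_expansion (sum d V) (\<lambda>x. \<Prod>v\<in>V. f v x)"
  using assms
  by (induction V rule: infinite_finite_induct)
    (auto intro: integral_expansion_one integral_expansion_mult)

text \<open>The unknowns are the coefficients of the monomials of degree at most \<open>M\<close> in
  \<open>CARD('v) + 1\<close> variables. Each product has level \<open>M\<close>, so the relation
  holds once one linear equation per exponent in \<open>R M\<close> is satisfied.\<close>

lemma small_integer_relation:
  fixes f :: "'v \<Rightarrow> complex ^ 'v \<Rightarrow> complex"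
  assumes f: "\<And>v. integral_expansion 1 (f v)" and g: "integral_expansion 1 g"
    and card: "Suc (h * (u * G ^ M)) ^ card (R M) < Suc h ^ u"
    and u: "u = (Suc M + CARD('v)) choose Suc CARD('v)"
  shows "\<exists>W :: ('v \<Rightarrow> nat) \<Rightarrow> nat \<Rightarrow> int. (\<exists>a\<in>exp_box M. \<exists>b\<le>M. W a b \<noteq> 0) \<and> (\<forall>a b. \<bar>W a b\<bar> \<le> int h) \<and>
    (\<forall>x. (\<Sum>a\<in>exp_box M. (\<Sum>b\<le>M. of_int (W a b) * g x ^ b) * mono_eval a (\<chi> v. f v x)) = 0)"
proof -
  define I :: "(nat \<times> ('v \<Rightarrow> nat)) set" where "I = (SIGMA b:{..M}. exps UNIV (M - b))"
  define \<Phi> where "\<Phi> = (\<lambda>(b, a) x. mono_eval a (\<chi> v. f v x) * g x ^ b)"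
  have I: "finite I" "card I = u"
    using sum_choose_shift[of M "CARD('v)"] by (simp_all add: I_def u finite_exps card_exps)
  have "integral_expansion M (\<Phi> i)" if "i \<in> I" for i
  proof -
    obtain a b where i: "i = (b, a)" "b \<le> M" "sum a UNIV \<le> M - b"
      using \<open>i \<in> I\<close> by (auto simp: I_def exps_def)
    have "integral_expansion (sum a UNIV + b) (\<Phi> i)"
      unfolding \<Phi>_def i mono_eval_def prod.case vec_lambda_beta
      by (intro integral_expansion_mult integral_expansion_prod integral_expansion_power f g)
    then show ?thesis
      by (rule integral_expansion_mono) (use i in simp)
  qed
  then have "\<forall>i\<in>I. \<exists>c :: ('v \<Rightarrow> nat) \<Rightarrow> int.
      (\<forall>x. \<Phi> i x = (\<Sum>k\<in>R M. of_int (c k) * mono_eval k x)) \<and> (\<Sum>k\<in>R M. \<bar>c k\<bar>) \<le> int G ^ M"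
    unfolding integral_expansion_def by blast
  from bchoice[OF this] obtain c :: "_ \<Rightarrow> ('v \<Rightarrow> nat) \<Rightarrow> int"
    where "\<forall>i\<in>I. (\<forall>x. \<Phi> i x = (\<Sum>k\<in>R M. of_int (c i k) * mono_eval k x)) \<and>
      (\<Sum>k\<in>R M. \<bar>c i k\<bar>) \<le> int G ^ M"
    by (rule exE)
  then have c: "\<And>i x. i \<in> I \<Longrightarrow> \<Phi> i x = (\<Sum>k\<in>R M. of_int (c i k) * mono_eval k x)"
      "\<And>i. i \<in> I \<Longrightarrow> (\<Sum>k\<in>R M. \<bar>c i k\<bar>) \<le> int G ^ M"
    by (blast, blast)
  have "(\<Sum>i\<in>I. \<bar>c i k\<bar>) \<le> int (u * G ^ M)" if "k \<in> R M" for k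
  proof -
    have "\<bar>c i k\<bar> \<le> int G ^ M" if "i \<in> I" for i
      using member_le_sum[OF \<open>k \<in> R M\<close>, of "\<lambda>k. \<bar>c i k\<bar>"] finite_R c(2)[OF that] by force
    then have "(\<Sum>i\<in>I. \<bar>c i k\<bar>) \<le> of_nat (card I) * int G ^ M"
      by (rule sum_bounded_above)
    then show ?thesis
      by (simp add: I)
  qed
  moreover have "Suc (h * (u * G ^ M)) ^ card (R M) < Suc h ^ card I"
    using card by (simp only: I)
  ultimately have "\<exists>w :: nat \<times> ('v \<Rightarrow> nat) \<Rightarrow> int. (\<exists>i\<in>I. w i \<noteq> 0) \<and> (\<forall>i\<in>I. \<bar>w i\<bar> \<le> int h) \<and>
      (\<forall>k\<in>R M. (\<Sum>i\<in>I. w i * c i k) = 0)"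
    by (intro siegel_lemma[OF I(1) finite_R])
  then obtain w where w: "\<exists>i\<in>I. w i \<noteq> 0" "\<forall>i\<in>I. \<bar>w i\<bar> \<le> int h" "\<forall>k\<in>R M. (\<Sum>i\<in>I. w i * c i k) = 0"
    by blast
  \<comment> \<open>Extension by zero from the simplex to the box, the shape to which the exponent
    weights apply.\<close>
  define W where "W a b = (if (b, a) \<in> I then w (b, a) else 0)" for a b
  have sub: "I \<subseteq> {..M} \<times> exp_box M"
  proof safe
    fix b a assume "(b, a) \<in> I"
    then have b: "b \<le> M" and a: "sum a UNIV \<le> M"
      by (auto simp: I_def exps_def)
    have "a v \<le> sum a UNIV" for v
      by (rule member_le_sum) auto
    then show "a \<in> exp_box M"
      using a order_trans by (auto simp: exp_box_def)
    show "b \<le> M"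
      by fact
  qed
  have "(\<Sum>a\<in>exp_box M. (\<Sum>b\<le>M. of_int (W a b) * g x ^ b) * mono_eval a (\<chi> v. f v x)) = 0" for x
  proof -
    have "(\<Sum>a\<in>exp_box M. (\<Sum>b\<le>M. of_int (W a b) * g x ^ b) * mono_eval a (\<chi> v. f v x)) =
        (\<Sum>a\<in>exp_box M. \<Sum>b\<le>M. of_int (W a b) * \<Phi> (b, a) x)"
      by (simp add: \<Phi>_def sum_distrib_left mult_ac)
    also have "\<dots> = (\<Sum>(b, a)\<in>{..M} \<times> exp_box M. of_int (W a b) * \<Phi> (b, a) x)"
      by (subst sum.swap) (simp add: sum.cartesian_product)
    also have "\<dots> = (\<Sum>i\<in>I. of_int (w i) * \<Phi> i x)"
      by (intro sum.mono_neutral_cong_right) (use sub in \<open>auto simp: W_def\<close>)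
    also have "\<dots> = (\<Sum>i\<in>I. \<Sum>k\<in>R M. of_int (w i * c i k) * mono_eval k x)"
      by (intro sum.cong) (auto simp: c(1) sum_distrib_left mult.assoc)
    also have "\<dots> = (\<Sum>k\<in>R M. of_int (\<Sum>i\<in>I. w i * c i k) * mono_eval k x)"
      unfolding of_int_sum sum_distrib_right by (rule sum.swap)
    also have "\<dots> = 0"
      using w(3) by simp
    finally show ?thesis .
  qed
  moreover have "\<exists>a\<in>exp_box M. \<exists>b\<le>M. W a b \<noteq> 0"
    using w(1) sub by (force simp: W_def)
  moreover have "\<bar>W a b\<bar> \<le> int h" for a b
    using w(2) by (simp add: W_def)
  ultimately show ?thesis
    by (intro exI[of _ W] conjI allI)
qed

end

section \<open>From the integer relation to bounds at the isolated zero\<close>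

theorem relation_bounds_isolated_zero:
  fixes f :: "'v::finite \<Rightarrow> complex ^ 'v \<Rightarrow> complex" and W :: "('v \<Rightarrow> nat) \<Rightarrow> nat \<Rightarrow> int"
  assumes f: "\<And>v. polyfun d (f v)" and zero: "\<And>v. f v z = 0"
    and iso: "z isolated_in {x. \<forall>v. f v x = 0}"
    and nz: "\<exists>a\<in>exp_box M. \<exists>b\<le>M. W a b \<noteq> 0" and h: "\<And>a b. \<bar>W a b\<bar> \<le> int h"
    and rel: "\<And>x. (\<Sum>a\<in>exp_box M. (\<Sum>b\<le>M. of_int (W a b) * (x $ k) ^ b) * mono_eval a (\<chi> v. f v x)) = 0"
    and k: "z $ k \<noteq> 0"
  shows "1 / (real h + 1) \<le> norm (z $ k) \<and> norm (z $ k) \<le> real h + 1"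
proof -
  obtain r0 where r0: "r0 > 0" "\<And>x. (\<forall>v. f v x = 0) \<Longrightarrow> dist z x < r0 \<Longrightarrow> x = z"
    using iso unfolding isolated_in_dist_Ex_iff by auto
  have onto: "\<exists>\<delta>>0. \<forall>w. norm w < \<delta> \<longrightarrow> (\<exists>x\<in>cball z r. \<forall>v. f v x = w $ v)" if "0 < r" "r < r0" for r
    using that r0(2) by (intro isolated_zero_onto_ball[OF f zero]) auto
  from exponent_weights[of "UNIV :: 'v set" M, OF finite]
  obtain w :: "'v \<Rightarrow> nat" where w0: "(\<forall>v. w v > 0) \<and> (\<forall>a b. (\<forall>v\<in>UNIV. a v \<le> M \<and> b v \<le> M) \<longrightarrow>
      (\<Sum>v\<in>UNIV. a v * w v) = (\<Sum>v\<in>UNIV. b v * w v) \<longrightarrow> (\<forall>v\<in>UNIV. a v = b v))"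
    by (rule exE)
  define y where "y e = (\<chi> v. e ^ w v)" for e :: complex
  \<comment> \<open>The radius \<open>r\<close> forces the solution close to \<open>z\<close>; the
    positive weights make \<open>y e\<close> tend to 0 with \<open>e\<close>, hence small enough to
    be attained.\<close>
  have near: "\<exists>e x. e \<noteq> 0 \<and> norm e < \<rho> \<and> dist z x < \<rho> \<and> (\<chi> v. f v x) = y e" if "\<rho> > 0" for \<rho>
  proof -
    define r where "r = min \<rho> r0 / 2"
    have r: "0 < r" "r < r0" "r < \<rho>"
      using r0(1) that by (auto simp: r_def min_def)
    obtain \<delta> where \<delta>: "\<delta> > 0" "\<And>w. norm w < \<delta> \<Longrightarrow> \<exists>x\<in>cball z r. \<forall>v. f v x = w $ v"
      using onto[OF r(1,2)] by blast
    have "isCont y 0"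
      unfolding y_def continuous_at by (intro tendsto_intros)
    moreover have "y 0 = 0"
      using w0 by (simp add: y_def vec_eq_iff zero_power)
    ultimately obtain s where s: "s > 0" "\<And>e. norm e < s \<Longrightarrow> norm (y e) < \<delta>"
      using \<delta>(1) unfolding continuous_at_eps_delta by (auto simp: dist_norm)
    define e :: complex where "e = of_real (min s \<rho> / 2)"
    have e: "e \<noteq> 0" "norm e < s" "norm e < \<rho>"
      using s(1) that by (auto simp: e_def min_def)
    obtain x where "x \<in> cball z r" "\<forall>v. f v x = y e $ v"
      using \<delta>(2)[OF s(2)[OF e(2)]] by blast
    then show ?thesis
      using e r(3) by (intro exI[of _ e] exI[of _ x]) (auto simp: vec_eq_iff)
  qed
  have "\<exists>e x. e \<noteq> 0 \<and> norm e < 1 / real (Suc n) \<and> dist z x < 1 / real (Suc n) \<and> (\<chi> v. f v x) = y e" for n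
    by (rule near) simp
  then obtain e x where ex: "\<And>n. e n \<noteq> 0" "\<And>n. norm (e n) < 1 / real (Suc n)"
      "\<And>n. dist z (x n) < 1 / real (Suc n)" "\<And>n. (\<chi> v. f v (x n)) = y (e n)"
    by metis
  have lim0: "(\<lambda>n. 1 / real (Suc n)) \<longlonglongrightarrow> 0"
    using LIMSEQ_inverse_real_of_nat by (simp add: inverse_eq_divide)
  have e0: "e \<longlonglongrightarrow> 0"
    by (rule Lim_null_comparison[OF _ lim0]) (use ex(2) less_imp_le in \<open>auto intro!: always_eventually\<close>)
  have "(\<lambda>n. dist (x n) z) \<longlonglongrightarrow> 0"
    by (rule Lim_null_comparison[OF _ lim0])
      (use ex(3) less_imp_le in \<open>auto intro!: always_eventually simp: dist_commute\<close>)
  then have "x \<longlonglongrightarrow> z"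
    using tendsto_dist_iff by blast
  then have xk: "(\<lambda>n. x n $ k) \<longlonglongrightarrow> z $ k"
    by (rule tendsto_vec_nth)
  \<comment> \<open>\<open>q a\<close> is the coefficient of the monomial \<open>a\<close> in the
    values of \<open>f\<close>, as a polynomial in the coordinate \<open>x $ k\<close>.\<close>
  define q where "q a t = (\<Sum>b\<le>M. of_int (W a b) * t ^ b)" for a and t :: complex
  have "\<exists>a\<in>exp_box M. q a \<noteq> (\<lambda>_. 0) \<and> q a (z $ k) = 0"
  proof (rule lowest_term_vanishes[where wt = "\<lambda>a. \<Sum>v\<in>UNIV. a v * w v" and e = e and s = "\<lambda>n. x n $ k"])
    show "inj_on (\<lambda>a. \<Sum>v\<in>UNIV. a v * w v) (exp_box M)"
      using w0 by (intro inj_onI ext) (auto simp: exp_box_def)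
    show "isCont (q a) (z $ k)" for a
      unfolding q_def by (intro continuous_intros)
    show "\<exists>a\<in>exp_box M. q a \<noteq> (\<lambda>_. 0)"
    proof -
      obtain a b where ab: "a \<in> exp_box M" "b \<le> M" "W a b \<noteq> 0"
        using nz by blast
      have "q a \<noteq> (\<lambda>_. 0)"
      proof
        assume "q a = (\<lambda>_. 0)"
        then have "\<forall>t. (\<Sum>i\<le>M. of_int (W a i) * t ^ i) = (0 :: complex)"
          unfolding q_def by (metis (no_types, lifting))
        then have "\<forall>i\<le>M. of_int (W a i) = (0 :: complex)"
          by (subst (asm) polyfun_eq_0)
        then show False
          using ab by simp
      qed
      then show ?thesis
        using ab(1) by blast
    qed
    show "(\<Sum>a\<in>exp_box M. q a (x n $ k) * e n ^ (\<Sum>v\<in>UNIV. a v * w v)) = 0" for n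
      using rel[of "x n"] unfolding ex(4)
      by (simp add: q_def y_def mono_eval_def power_sum mult.commute flip: power_mult)
  qed (use ex(1) e0 xk in auto)
  then obtain a where a: "a \<in> exp_box M" "q a \<noteq> (\<lambda>_. 0)" "q a (z $ k) = 0"
    by blast
  have "\<exists>b\<le>M. W a b \<noteq> 0"
    using a(2) unfolding q_def by (rule contrapos_np) auto
  then show ?thesis
    using a(3) k h integer_root_upper_bound[of M "W a" h] integer_root_lower_bound[of M "W a" h]
    unfolding q_def by blast
qed

section \<open>The KKT system\<close>

text \<open>The restriction to mixed quadratic monomials is what places the system at level 1 of
  \<open>kkt_exps\<close>.\<close>

definition kkt_monomials :: "(('n, 'm) kkt_var \<Rightarrow>\<^sub>0 nat) set" where
  "kkt_monomials = {0} \<union> range (\<lambda>v. Poly_Mapping.single v 1) \<union>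
     range (\<lambda>(s, t). Poly_Mapping.single (XVar s) 1 + Poly_Mapping.single (SVar t) 1)"

definition kkt_bilinear :: "(('n, 'm) kkt_var, int) mpoly \<Rightarrow> bool" where
  "kkt_bilinear f \<longleftrightarrow> Poly_Mapping.keys f \<subseteq> kkt_monomials"

lemma kkt_bilinear_add: "kkt_bilinear f \<Longrightarrow> kkt_bilinear g \<Longrightarrow> kkt_bilinear (f + g)"
  unfolding kkt_bilinear_def using keys_add[of f g] by blast

lemma kkt_bilinear_diff: "kkt_bilinear f \<Longrightarrow> kkt_bilinear g \<Longrightarrow> kkt_bilinear (f - g)"
  unfolding kkt_bilinear_def using keys_diff[of f g] by blast

lemma kkt_bilinear_sum: "(\<And>i. i \<in> I \<Longrightarrow> kkt_bilinear (f i)) \<Longrightarrow> kkt_bilinear (sum f I)"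
  unfolding kkt_bilinear_def using keys_sum[of f I] by blast

lemma kkt_bilinear_mconst: "kkt_bilinear (mconst c)"
  by (simp add: kkt_bilinear_def mconst_def kkt_monomials_def)

lemma kkt_bilinear_mvar: "kkt_bilinear (mvar v)"
  by (simp add: kkt_bilinear_def mvar_def kkt_monomials_def)

lemma kkt_bilinear_mconst_mult: "kkt_bilinear f \<Longrightarrow> kkt_bilinear (mconst c * f)"
  unfolding kkt_bilinear_def using keys_mult[of "mconst c" f] by (auto simp: mconst_def split: if_splits)

lemma kkt_bilinear_mvar_mult: "kkt_bilinear (mvar (XVar s) * mvar (SVar t))"
  by (auto simp: kkt_bilinear_def mvar_def mult_single kkt_monomials_def)

lemma kkt_bilinear_kkt_poly: "kkt_bilinear (kkt_poly A b C e)"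
proof (cases e)
  case (Primal i)
  then show ?thesis
    by (simp add: trace_def matrix_matrix_mult_def mconst_mat_def X_mat_def)
      (intro kkt_bilinear_diff kkt_bilinear_sum kkt_bilinear_mconst kkt_bilinear_mconst_mult kkt_bilinear_mvar)
next
  case (Dual u)
  have "kkt_bilinear (dual_mat A C $ k $ l)" for k l
    unfolding dual_mat_def vector_add_component vector_minus_component sum_component
      S_mat_def mconst_mat_def vec_lambda_beta mult.commute[of "mvar _"]
    by (intro kkt_bilinear_add kkt_bilinear_diff kkt_bilinear_sum kkt_bilinear_mconst
        kkt_bilinear_mconst_mult kkt_bilinear_mvar)
  then show ?thesis
    by (simp add: Dual sym_entry_def split: prod.splits)
next
  case (Compl i j)
  then show ?thesis
    by (simp add: matrix_matrix_mult_def X_mat_def S_mat_def)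
      (intro kkt_bilinear_sum kkt_bilinear_mvar_mult)
qed

lemma card_kkt_monomials:
  fixes a N :: nat
  defines "a \<equiv> CARD('n::finite uprod)" and "N \<equiv> CARD(('n, 'm::finite) kkt_var)"
  shows "finite (kkt_monomials :: (('n, 'm) kkt_var \<Rightarrow>\<^sub>0 nat) set)"
    and "card (kkt_monomials :: (('n, 'm) kkt_var \<Rightarrow>\<^sub>0 nat) set) \<le> 1 + N + a\<^sup>2"
proof -
  define V :: "(('n, 'm) kkt_var \<Rightarrow>\<^sub>0 nat) set" where "V = range (\<lambda>v. Poly_Mapping.single v 1)"
  define B :: "(('n, 'm) kkt_var \<Rightarrow>\<^sub>0 nat) set"
    where "B = range (\<lambda>(s, t). Poly_Mapping.single (XVar s) 1 + Poly_Mapping.single (SVar t) 1)"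
  have eq: "kkt_monomials = {0} \<union> V \<union> B"
    by (simp add: kkt_monomials_def V_def B_def)
  show "finite (kkt_monomials :: (('n, 'm) kkt_var \<Rightarrow>\<^sub>0 nat) set)"
    unfolding eq by (simp add: V_def B_def)
  have "card ({0} \<union> V \<union> B) \<le> card {0 :: ('n, 'm) kkt_var \<Rightarrow>\<^sub>0 nat} + card V + card B"
    by (meson add_right_mono card_Un_le order_trans)
  also have "\<dots> \<le> 1 + N + a\<^sup>2"
  proof (intro add_mono)
    show "card V \<le> N"
      unfolding V_def N_def by (rule card_image_le) simp
    have "card B \<le> CARD('n uprod \<times> 'n uprod)"
      unfolding B_def by (rule card_image_le) simp
    then show "card B \<le> a\<^sup>2"
      by (simp add: a_def power2_eq_square)
  qed simp
  finally show "card (kkt_monomials :: (('n, 'm) kkt_var \<Rightarrow>\<^sub>0 nat) set) \<le> 1 + N + a\<^sup>2"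
    unfolding eq .
qed

text \<open>The joint degrees in \<open>(X, y)\<close> and in \<open>(S, y)\<close> are each at most
  1 on every monomial of the system, quadratic ones included. Products of \<open>k\<close> such
  polynomials stay at level \<open>k\<close>, although their total degree may reach
  \<open>2 * k\<close>.\<close>

definition kkt_exps :: "nat \<Rightarrow> (('n::finite, 'm::finite) kkt_var \<Rightarrow> nat) set" where
  "kkt_exps = biexps (range XVar) (range SVar) (range YVar)"

lemma lookup_kkt_monomials:
  assumes "\<alpha> \<in> (kkt_monomials :: (('n::finite, 'm::finite) kkt_var \<Rightarrow>\<^sub>0 nat) set)"
  shows "Poly_Mapping.lookup \<alpha> \<in> kkt_exps 1"
proof -
  have single: "sum (Poly_Mapping.lookup (Poly_Mapping.single v (Suc 0))) A = (if v \<in> A then 1 else 0)"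
    for v :: "('n, 'm) kkt_var" and A
    by (simp add: lookup_single when_def)
  show ?thesis
    using assms
    by (auto simp: kkt_monomials_def kkt_exps_def biexps_def lookup_add single sum.distrib
        UNIV_kkt_var[symmetric] image_iff)
qed

lemma meval_complex_mpoly:
  "meval (complex_mpoly f) x =
    (\<Sum>\<alpha>\<in>Poly_Mapping.keys f. of_int (Poly_Mapping.lookup f \<alpha>) * mono_eval (Poly_Mapping.lookup \<alpha>) x)"
proof -
  have l: "Poly_Mapping.lookup (complex_mpoly f) \<alpha> = of_int (Poly_Mapping.lookup f \<alpha>)" for \<alpha>
    by (simp add: complex_mpoly_def map.rep_eq when_def)
  have "Poly_Mapping.keys (complex_mpoly f) = Poly_Mapping.keys f"
    by (auto simp: in_keys_iff l)
  then show ?thesis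
    by (simp add: meval_def l mono_eval_def)
qed

lemma kkt_filtration:
  assumes "G \<ge> 1"
  shows "exponent_filtration (kkt_exps :: nat \<Rightarrow> (('n::finite, 'm::finite) kkt_var \<Rightarrow> nat) set) G"
proof
  show "finite (kkt_exps j :: (('n, 'm) kkt_var \<Rightarrow> nat) set)" for j
    unfolding kkt_exps_def by (rule biexps_split(1)) auto
qed (use assms in \<open>auto simp: kkt_exps_def biexps_def sum.distrib\<close>)

lemma card_kkt_exps:
  fixes a :: nat
  defines "a \<equiv> CARD('n::finite uprod)"
  shows "card (kkt_exps k :: (('n, 'm::finite) kkt_var \<Rightarrow> nat) set) \<le>
    ((2 * a) choose a) * ((k + (2 * a + CARD('m))) choose (2 * a + CARD('m)))"
proof -
  have "card (range (YVar :: 'm \<Rightarrow> ('n, 'm) kkt_var)) = CARD('m)"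
    by (intro card_image inj_onI) simp
  moreover have "card (kkt_exps k :: (('n, 'm::finite) kkt_var \<Rightarrow> nat) set) \<le>
    ((2 * a) choose a) * ((k + (2 * a + card (range (YVar :: 'm \<Rightarrow> ('n, 'm) kkt_var)))) choose
      (2 * a + card (range (YVar :: 'm \<Rightarrow> ('n, 'm) kkt_var))))"
    unfolding kkt_exps_def a_def
    by (rule card_biexps_le) (auto intro!: card_image inj_onI)
  ultimately show ?thesis
    by simp
qed

lemma kkt_bilinear_integral_expansion:
  fixes f :: "(('n::finite, 'm::finite) kkt_var, int) mpoly"
  assumes f: "kkt_bilinear f" and G: "G \<ge> 1"
    and coeff: "\<And>\<alpha>. \<bar>Poly_Mapping.lookup f \<alpha>\<bar> \<le> int B"
    and B: "(1 + CARD(('n, 'm) kkt_var) + (CARD('n uprod))\<^sup>2) * B \<le> G"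
  shows "exponent_filtration.integral_expansion kkt_exps G 1 (meval (complex_mpoly f))"
proof -
  interpret exponent_filtration "kkt_exps :: nat \<Rightarrow> (('n, 'm) kkt_var \<Rightarrow> nat) set" G
    using G by (rule kkt_filtration)
  \<comment> \<open>Over finitely many variables every exponent function is finitely supported, so
    \<open>Abs_poly_mapping\<close> inverts \<open>lookup\<close>; \<open>c\<close> is 0 off the
    keys.\<close>
  define c where "c e = Poly_Mapping.lookup f (Abs_poly_mapping e)" for e
  have c: "c (Poly_Mapping.lookup \<alpha>) = Poly_Mapping.lookup f \<alpha>" for \<alpha>
    by (simp add: c_def)
  have e: "e = Poly_Mapping.lookup (Abs_poly_mapping e)" for e :: "('n, 'm) kkt_var \<Rightarrow> nat"
    by simp
  have keys: "Poly_Mapping.keys f \<subseteq> kkt_monomials"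
    using f by (simp add: kkt_bilinear_def)
  \<comment> \<open>Stated for any commutative monoid, to serve both the complex values and the
    integer coefficient sum.\<close>
  have reindex: "(\<Sum>e\<in>kkt_exps 1. h e) = (\<Sum>\<alpha>\<in>Poly_Mapping.keys f. h (Poly_Mapping.lookup \<alpha>))"
    if h: "\<And>e. c e = 0 \<Longrightarrow> h e = 0" for h :: "_ \<Rightarrow> 'x::comm_monoid_add"
  proof -
    have "(\<Sum>e\<in>kkt_exps 1. h e) = (\<Sum>e\<in>Poly_Mapping.lookup ` Poly_Mapping.keys f. h e)"
    proof (rule sum.mono_neutral_right)
      show "Poly_Mapping.lookup ` Poly_Mapping.keys f \<subseteq> kkt_exps 1"
        using keys lookup_kkt_monomials by blast
      show "\<forall>e\<in>kkt_exps 1 - Poly_Mapping.lookup ` Poly_Mapping.keys f. h e = 0"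
      proof
        fix e assume "e \<in> kkt_exps 1 - Poly_Mapping.lookup ` Poly_Mapping.keys f"
        then have "Abs_poly_mapping e \<notin> Poly_Mapping.keys f"
          using e[of e] by blast
        then show "h e = 0"
          by (intro h) (simp add: c_def in_keys_iff)
      qed
    qed (rule finite_R)
    also have "\<dots> = (\<Sum>\<alpha>\<in>Poly_Mapping.keys f. h (Poly_Mapping.lookup \<alpha>))"
      by (subst sum.reindex) (auto intro: inj_onI poly_mapping_eqI)
    finally show ?thesis .
  qed
  have "meval (complex_mpoly f) x = (\<Sum>e\<in>kkt_exps 1. of_int (c e) * mono_eval e x)" for x
    unfolding meval_complex_mpoly by (subst reindex) (simp_all add: c)
  moreover have "(\<Sum>e\<in>kkt_exps 1. \<bar>c e\<bar>) \<le> int G ^ 1"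
  proof -
    have "(\<Sum>e\<in>kkt_exps 1. \<bar>c e\<bar>) = (\<Sum>\<alpha>\<in>Poly_Mapping.keys f. \<bar>Poly_Mapping.lookup f \<alpha>\<bar>)"
      by (subst reindex) (simp_all add: c)
    also have "\<dots> \<le> of_nat (card (Poly_Mapping.keys f)) * int B"
      by (rule sum_bounded_above) (rule coeff)
    also have "card (Poly_Mapping.keys f) \<le> 1 + CARD(('n, 'm) kkt_var) + (CARD('n uprod))\<^sup>2"
      using card_mono[OF card_kkt_monomials(1) keys] card_kkt_monomials(2) by (rule order_trans)
    then have "int (card (Poly_Mapping.keys f)) * int B \<le> int (1 + CARD(('n, 'm) kkt_var) + (CARD('n uprod))\<^sup>2) * int B"
      by (intro mult_right_mono) (simp_all only: of_nat_le_iff of_nat_0_le_iff)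
    also have "\<dots> \<le> int G ^ 1"
      using B by (simp only: of_nat_mult[symmetric] power_one_right of_nat_le_iff)
    finally show ?thesis by simp
  qed
  ultimately show ?thesis
    unfolding integral_expansion_def by (intro exI[of _ c]) simp
qed

lemma polyfun_meval:
  "\<exists>d. \<forall>f. kkt_bilinear f \<longrightarrow> polyfun d (meval (complex_mpoly (f :: (('n::finite, 'm::finite) kkt_var, int) mpoly)))"
proof -
  let ?d = "\<Sum>\<alpha>\<in>(kkt_monomials :: (('n, 'm) kkt_var \<Rightarrow>\<^sub>0 nat) set). sum (Poly_Mapping.lookup \<alpha>) UNIV"
  have "polyfun ?d (meval (complex_mpoly f))" if f: "kkt_bilinear f" for f :: "(('n, 'm) kkt_var, int) mpoly"
    unfolding meval_complex_mpoly
  proof (rule polyfun_sum)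
    fix \<alpha> assume "\<alpha> \<in> Poly_Mapping.keys f"
    then have "\<alpha> \<in> kkt_monomials"
      using f by (auto simp: kkt_bilinear_def)
    then have "sum (Poly_Mapping.lookup \<alpha>) UNIV \<le> ?d"
      by (rule member_le_sum) (auto simp: card_kkt_monomials)
    then have "polyfun (0 + ?d) (\<lambda>x. of_int (Poly_Mapping.lookup f \<alpha>) * mono_eval (Poly_Mapping.lookup \<alpha>) x)"
      by (intro polyfun.mult polyfun.const polyfun_mono[OF polyfun_mono_eval])
    then show "polyfun ?d (\<lambda>x. of_int (Poly_Mapping.lookup f \<alpha>) * mono_eval (Poly_Mapping.lookup \<alpha>) x)"
      by simp
  qed
  then show ?thesis
    by blast
qed

section \<open>Choice of the degree and of the exponent\<close>

lemma exp_dominates_linear: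
  fixes c N :: nat
  shows "\<exists>K. c * (1 + K) < 2 ^ K \<and> N + 1 \<le> 2 ^ K"
proof -
  \<comment> \<open>The witness is \<open>K = 2 * j\<close>: squaring
    \<open>Suc j \<le> 2 ^ j\<close> gives a quadratic lower bound, and \<open>j \<ge> 2 * c\<close>
    makes it exceed \<open>c * (1 + 2 * j)\<close>.\<close>
  define j where "j = 2 * c + N"
  have "Suc j \<le> 2 ^ j"
    using less_exp[of j] by (rule Suc_leI)
  from mult_mono[OF this this] have "Suc j * Suc j \<le> 2 ^ j * 2 ^ j"
    by simp
  also have "\<dots> = 2 ^ (2 * j)"
    by (simp add: power_add[symmetric] mult_2)
  finally have *: "Suc j * Suc j \<le> 2 ^ (2 * j)" .
  have "2 * (c * (1 + 2 * j)) \<le> j * (1 + 2 * j)"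
    unfolding mult.assoc[symmetric] by (rule mult_right_mono) (simp_all add: j_def)
  then have "c * (1 + 2 * j) < Suc j * Suc j"
    by (simp add: algebra_simps)
  moreover have "N + 1 \<le> Suc j * Suc j"
    by (simp add: j_def)
  ultimately show ?thesis
    using * by (intro exI[of _ "2 * j"]) linarith
qed

text \<open>The logarithmic terms become negligible along the degrees \<open>M = 2\<^sup>K - (N + 1)\<close>.\<close>

lemma siegel_condition_for_large_degree:
  fixes \<beta> \<eta> g N :: nat
  assumes \<eta>: "(N + 1) * \<beta> * g < \<eta>"
  shows "\<exists>M. \<forall>r \<le> \<beta> * ((M + N) choose N).
    Suc ((2 ^ \<eta> - 1) * (((Suc M + N) choose Suc N) * (2 ^ g) ^ M)) ^ r
      < Suc (2 ^ \<eta> - 1) ^ ((Suc M + N) choose Suc N)"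
proof -
  \<comment> \<open>With this \<open>c\<close>, the part of the exponent free of \<open>M\<close>
    will amount to less than one unit \<open>2 ^ K\<close>.\<close>
  define c where "c = \<beta> * (N + 1) * (\<eta> + N + 1)"
  obtain K where K: "c * (1 + K) < 2 ^ K" "N + 1 \<le> 2 ^ K"
    using exp_dominates_linear by blast
  define M where "M = 2 ^ K - (N + 1)"
  have M: "Suc M + N = 2 ^ K"
    using K(2) by (simp add: M_def)
  define b where "b = (M + N) choose N"
  define u where "u = (Suc M + N) choose Suc N"
  \<comment> \<open>Bits of the base: \<open>\<eta>\<close> for the height,
    \<open>K * (N + 1)\<close> for the number \<open>u\<close> of unknowns, \<open>g * M\<close> for
    the coefficients.\<close>
  define E where "E = \<eta> + K * (N + 1) + g * M"
  have b: "b > 0"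
    by (simp add: b_def)
  have u: "u > 0"
    by (simp add: u_def)
  have "Suc N * u = Suc (M + N) * b"
    unfolding u_def b_def add_Suc by (rule Suc_times_binomial)
  moreover have "Suc (M + N) = 2 ^ K"
    using M by simp
  ultimately have ub: "(N + 1) * u = 2 ^ K * b"
    by (metis Suc_eq_plus1)
  have "u \<le> (Suc M + N) ^ Suc N"
    unfolding u_def by (rule binomial_le_pow) simp
  then have u2: "u \<le> 2 ^ (K * (N + 1))"
    unfolding M by (simp only: power_mult[symmetric] Suc_eq_plus1)
  have base: "Suc ((2 ^ \<eta> - 1) * (u * (2 ^ g) ^ M)) \<le> 2 ^ E"
  proof -
    have "Suc ((2 ^ \<eta> - 1) * (u * (2 ^ g) ^ M)) \<le> (2 ^ \<eta> - 1) * (u * (2 ^ g) ^ M) + u * (2 ^ g) ^ M"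
      using u by (simp add: Suc_le_eq)
    also have "\<dots> = 2 ^ \<eta> * (u * (2 ^ g) ^ M)"
      by (simp add: algebra_simps)
    also have "\<dots> \<le> 2 ^ \<eta> * (2 ^ (K * (N + 1)) * (2 ^ g) ^ M)"
      by (intro mult_left_mono mult_right_mono u2) simp_all
    also have "\<dots> = 2 ^ E"
      by (simp add: E_def power_add power_mult)
    finally show ?thesis .
  qed
  \<comment> \<open>After multiplication by \<open>N + 1\<close> and
    \<open>(N + 1) * u = 2 ^ K * b\<close>, multiples of \<open>2 ^ K\<close> are compared:
    \<open>g * M\<close> contributes at most \<open>(N + 1) * \<beta> * g\<close> units, the rest
    less than one, and the strict hypothesis on \<open>\<eta>\<close> leaves room for that
    one.\<close>
  have "E * (\<beta> * b) < \<eta> * u"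
  proof -
    have "\<eta> + K * (N + 1) \<le> (\<eta> + N + 1) * (1 + K)"
      by (simp add: algebra_simps)
    then have "\<beta> * (N + 1) * (\<eta> + K * (N + 1)) \<le> \<beta> * (N + 1) * ((\<eta> + N + 1) * (1 + K))"
      by (rule mult_left_mono) simp
    also have "\<dots> < 2 ^ K"
      using K(1) unfolding c_def by (simp only: mult.assoc)
    finally have 1: "\<beta> * (N + 1) * (\<eta> + K * (N + 1)) < 2 ^ K" .
    have "\<beta> * (N + 1) * (g * M) \<le> \<beta> * (N + 1) * (g * 2 ^ K)"
      by (intro mult_left_mono) (use M in simp_all)
    also have "\<dots> = (N + 1) * \<beta> * g * 2 ^ K"
      by simp
    finally have 2: "\<beta> * (N + 1) * (g * M) \<le> (N + 1) * \<beta> * g * 2 ^ K" .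
    have "E * \<beta> * (N + 1) = \<beta> * (N + 1) * (\<eta> + K * (N + 1)) + \<beta> * (N + 1) * (g * M)"
      by (simp add: E_def algebra_simps)
    also have "\<dots> < 2 ^ K + (N + 1) * \<beta> * g * 2 ^ K"
      using 1 2 by linarith
    also have "\<dots> = Suc ((N + 1) * \<beta> * g) * 2 ^ K"
      by simp
    also have "\<dots> \<le> \<eta> * 2 ^ K"
      using \<eta> by (intro mult_right_mono) simp_all
    finally have "E * \<beta> * (N + 1) * b < \<eta> * 2 ^ K * b"
      using b by simp
    then have "(N + 1) * (E * (\<beta> * b)) < (N + 1) * (\<eta> * u)"
      using ub by (simp only: mult_ac)
    then show ?thesis
      by (simp only: mult_less_cancel1)
  qed
  then have "Suc ((2 ^ \<eta> - 1) * (u * (2 ^ g) ^ M)) ^ r < Suc (2 ^ \<eta> - 1) ^ u" if "r \<le> \<beta> * b" for r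
  proof -
    have "Suc ((2 ^ \<eta> - 1) * (u * (2 ^ g) ^ M)) ^ r \<le> (2 ^ E) ^ r"
      by (rule power_mono[OF base]) simp
    also have "\<dots> = 2 ^ (E * r)"
      by (simp add: power_mult)
    also have "\<dots> < 2 ^ (\<eta> * u)"
    proof (rule power_strict_increasing)
      have "E * r \<le> E * (\<beta> * b)"
        using that by (rule mult_left_mono) simp
      then show "E * r < \<eta> * u"
        using \<open>E * (\<beta> * b) < \<eta> * u\<close> by linarith
    qed simp
    also have "\<dots> = Suc (2 ^ \<eta> - 1) ^ u"
      by (simp add: power_mult)
    finally show ?thesis .
  qed
  then show ?thesis
    unfolding u_def b_def by blast
qed

text \<open>The left side bounds the number \<open>p\<close> of equations, which enters through \<open>\<tau>\<^sub>1\<close>, times the number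
  of monomials in one polynomial of the system; absorbing it in a power of two costs only
  \<open>N + 1\<close> bits.\<close>

lemma kkt_size_le:
  fixes a m p :: nat
  assumes "a \<ge> 1" "m \<ge> 1" "p + 1 \<le> m + 3 * a"
  shows "p * (1 + (2 * a + m) + a\<^sup>2) \<le> 2 ^ (2 * a + m + 1)"
proof -
  \<comment> \<open>The case \<open>m = 1\<close> with \<open>a = i + 1\<close>: it starts at
    \<open>15 \<le> 16\<close>, and raising \<open>i\<close> by one costs at most a factor
    4.\<close>
  have base: "(3 * i + 3) * (i\<^sup>2 + 4 * i + 5) \<le> 2 ^ (2 * i + 4)" for i :: nat
  proof (induction i)
    case (Suc i)
    have "(3 * Suc i + 3) * ((Suc i)\<^sup>2 + 4 * Suc i + 5) \<le> 4 * ((3 * i + 3) * (i\<^sup>2 + 4 * i + 5))"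
      by (simp add: power2_eq_square algebra_simps)
    also have "\<dots> \<le> 4 * 2 ^ (2 * i + 4)"
      using Suc.IH by (rule mult_left_mono) simp
    also have "\<dots> = 2 ^ (2 * Suc i + 4)"
      by (simp add: power_add)
    finally show ?case .
  qed simp
  have step: "(k + 3 * i + 3) * (k + (i\<^sup>2 + 4 * i + 5)) \<le> 2 ^ (2 * i + k + 4)" for i k :: nat
  proof (induction k)
    case (Suc k)
    define x where "x = k + 3 * i + 3"
    define y where "y = k + (i\<^sup>2 + 4 * i + 5)"
    \<comment> \<open>Raising \<open>m\<close> by one raises both factors by one, which at most
      doubles the product since they are at least 3 and 5.\<close>
    have "x + y + 1 \<le> x * y"
    proof -
      obtain x' y' where "x = x' + 3" "y = y' + 5"
        by (metis x_def y_def add.assoc)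
      then show ?thesis
        by (simp add: algebra_simps)
    qed
    then have "Suc x * Suc y \<le> 2 * (x * y)"
      by simp
    also have "\<dots> \<le> 2 * 2 ^ (2 * i + k + 4)"
      using Suc.IH by (simp add: x_def y_def)
    also have "\<dots> = 2 ^ (2 * i + Suc k + 4)"
      by (simp only: add_Suc_right add_Suc power_Suc)
    finally show ?case
      by (simp add: x_def y_def)
  qed (use base in simp)
  obtain i k where ik: "a = Suc i" "m = Suc k"
    using assms by (metis Suc_le_D One_nat_def)
  have "p * (1 + (2 * a + m) + a\<^sup>2) \<le> (k + 3 * i + 3) * (k + (i\<^sup>2 + 4 * i + 5))"
    using assms(3) unfolding ik by (intro mult_mono) (simp_all add: power2_eq_square)
  also have "\<dots> \<le> 2 ^ (2 * i + k + 4)"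
    by (rule step)
  also have "2 * i + k + 4 = 2 * a + m + 1"
    by (simp add: ik)
  finally show ?thesis .
qed

text \<open>The exponent as a natural number, so that \<open>2 ^ eta_nat N \<tau> - 1\<close> can be
  the height in Siegel's lemma.\<close>

definition eta_nat :: "nat \<Rightarrow> nat \<Rightarrow> nat" where
  "eta_nat N \<tau> = (N\<^sup>2 - N) div 2 + 2 ^ N + N * (\<tau> + N + 2) * 2 ^ (N - 1)"

lemma eta1_eq_eta_nat: "eta1 n m \<tau> = real (eta_nat (kkt_N n m) \<tau>)"
proof -
  define N where "N = kkt_N n m"
  have "N \<le> N\<^sup>2"
    by (simp add: power2_eq_square)
  moreover have "even (N\<^sup>2 - N)"
    by (simp add: power2_eq_square)
  ultimately have e: "real ((N\<^sup>2 - N) div 2) = ((real N)\<^sup>2 - real N) / 2"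
    by (simp add: real_of_nat_div of_nat_diff)
  show ?thesis
    unfolding eta1_def eta_nat_def Let_def N_def[symmetric] of_nat_add e by (simp add: algebra_simps)
qed

text \<open>\<open>2 * N * (\<tau> + N + 2)\<close> exceeds
  \<open>(N + 1) * (\<tau> + 2 * N + 1)\<close> by \<open>(N - 1) * (\<tau> + 1)\<close>. So the
  last summand of \<open>eta_nat\<close> covers the left side, and the positive \<open>2 ^ N\<close>
  makes the inequality strict.\<close>

lemma eta_nat_bound:
  assumes "N \<ge> 2"
  shows "(N + 1) * 2 ^ (N - 2) * (\<tau> + 2 * N + 1) < eta_nat N \<tau>"
proof -
  obtain k where N: "N = Suc (Suc k)"
    using assms by (metis add_2_eq_Suc le_Suc_ex)
  have "(N + 1) * (\<tau> + 2 * N + 1) \<le> 2 * (N * (\<tau> + N + 2))"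
    unfolding N by (simp add: algebra_simps)
  then have "(N + 1) * (\<tau> + 2 * N + 1) * 2 ^ k \<le> 2 * (N * (\<tau> + N + 2)) * 2 ^ k"
    by (rule mult_right_mono) simp
  moreover have "N - 2 = k" "N - 1 = Suc k"
    by (simp_all add: N)
  ultimately have "(N + 1) * 2 ^ (N - 2) * (\<tau> + 2 * N + 1) \<le> N * (\<tau> + N + 2) * 2 ^ (N - 1)"
    by (simp only: power_Suc mult_ac)
  moreover have "(0::nat) < 2 ^ N"
    by simp
  ultimately show ?thesis
    unfolding eta_nat_def by linarith
qed

text \<open>No logarithm is spent: with \<open>Q = n^2 * m\<close> one has
  \<open>N \<le> 3 * Q\<close>, and the three summands of the exponent are at most 9, 1 and 18 times
  \<open>Q * Q * 2 ^ N * t\<close>.\<close>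

lemma eta1_soft_bigo:
  "(\<lambda>(n, m, t). eta1 n m t) \<in> soft_bigo (\<lambda>(n, m, t).
     real n ^ 4 * real m ^ 2 * 2 ^ (n * (n + 1) + m) * real t)"
proof -
  have "eta1 n m t \<le> 64 * (real n ^ 4 * real m ^ 2 * 2 ^ (n * (n + 1) + m) * real t)"
    if "n \<ge> 1" "m \<ge> 1" "t \<ge> 1" for n m t :: nat
  proof -
    define N where "N = kkt_N n m"
    define Q where "Q = n\<^sup>2 * m"
    define X where "X = Q * Q * 2 ^ N * t"
    have "n * n * 1 \<le> n * n * m" "n * 1 \<le> n * (n * m)" "1 * m \<le> (n * n) * m"
      using that by (intro mult_left_mono mult_right_mono; simp)+
    moreover have "N = n * n * 1 + n * 1 + 1 * m"
      by (simp add: N_def kkt_N_def)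
    moreover have "3 * Q = n * n * m + n * (n * m) + (n * n) * m"
      by (simp add: Q_def power2_eq_square)
    ultimately have N: "N \<le> 3 * Q"
      by linarith
    have N1: "1 \<le> N" "1 \<le> Q"
      using that by (simp_all add: N_def kkt_N_def Q_def)
    have p: "(1::nat) \<le> 2 ^ N" "(2::nat) ^ (N - 1) \<le> 2 ^ N"
      by (simp_all add: power_increasing)
    have Q2: "Q * 1 \<le> Q * Q"
      using N1 by (intro mult_left_mono) simp_all
    have "N * N \<le> (3 * Q) * (3 * Q)"
      using N by (intro mult_mono) simp_all
    then have NN: "N\<^sup>2 \<le> 9 * (Q * Q)"
      by (simp add: power2_eq_square)
    have "(N\<^sup>2 - N) div 2 \<le> 9 * X"
    proof -
      have "(N\<^sup>2 - N) div 2 \<le> 9 * (Q * Q) * 1 * 1"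
        using NN by simp
      also have "\<dots> \<le> 9 * (Q * Q) * 2 ^ N * t"
        using p(1) that(3) by (intro mult_mono) simp_all
      finally show ?thesis
        by (simp only: X_def mult.assoc)
    qed
    moreover have "2 ^ N \<le> X"
    proof -
      have "1 * 2 ^ N * 1 \<le> (Q * Q) * 2 ^ N * t"
        using N1 Q2 that(3) by (intro mult_mono) simp_all
      then show ?thesis
        by (simp add: X_def mult.assoc)
    qed
    moreover have "N * (t + N + 2) * 2 ^ (N - 1) \<le> 18 * X"
    proof -
      have "t + N + 2 \<le> 6 * Q * t"
      proof -
        have "1 * t \<le> Q * t" "Q * 1 \<le> Q * t" "1 * 1 \<le> Q * t"
          using N1 that(3) by (intro mult_mono; simp)+
        then show ?thesis
          using N by linarith
      qed
      then have "N * (t + N + 2) * 2 ^ (N - 1) \<le> (3 * Q) * (6 * Q * t) * 2 ^ N"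
        using N p(2) by (intro mult_mono) simp_all
      then show ?thesis
        by (simp add: X_def mult_ac)
    qed
    ultimately have "eta_nat N t \<le> 64 * (Q * Q * 2 ^ N * t)"
      unfolding eta_nat_def X_def[symmetric] by linarith
    then have "real (eta_nat N t) \<le> real (64 * (Q * Q * 2 ^ N * t))"
      by (simp only: of_nat_le_iff)
    also have "\<dots> = 64 * (real n ^ 4 * real m ^ 2 * 2 ^ N * real t)"
      by (simp add: Q_def power2_eq_square power4_eq_xxxx)
    finally show ?thesis
      by (simp add: eta1_eq_eta_nat N_def kkt_N_def)
  qed
  moreover have "eta1 n m t \<ge> 0" for n m t
    by (simp add: eta1_eq_eta_nat)
  ultimately have "(\<lambda>(n, m, t). eta1 n m t) \<in> O[principal {(n, m, t). n \<ge> 1 \<and> m \<ge> 1 \<and> t \<ge> 1}](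
       \<lambda>(n, m, t). (real n ^ 4 * real m ^ 2 * 2 ^ (n * (n + 1) + m) * real t) * log 2 (real (n + m + t)) ^ 0)"
    by (intro landau_o.bigI[of 64]) (auto simp: eventually_principal)
  then show ?thesis
    unfolding soft_bigo_def by (intro CollectI exI[of _ 0]) (simp add: case_prod_unfold)
qed

section \<open>Bounds for the squared-up KKT system\<close>

lemma two_powr_tau1:
  assumes "kkt_p n m > 0"
  shows "2 powr (tau1 n m \<tau>) = real (2 ^ (\<tau> + kkt_N n m) * kkt_p n m)"
  using assms by (simp add: tau1_def powr_add powr_realpow[symmetric])

theorem theorem4p1:
  fixes A :: "'m::finite \<Rightarrow> int ^ 'n::finite ^ 'n"
    and b :: "int ^ 'm"
    and C :: "int ^ 'n ^ 'n"
    and \<tau> :: nat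
    and F :: "nat \<Rightarrow> (('n, 'm) kkt_var, int) mpoly"
    and \<gamma> :: "complex ^ ('n, 'm) kkt_var"
  assumes "\<And>i. transpose (A i) = A i"
    and "transpose C = C"
    and "\<And>e. coeffs_bitsize_le (kkt_poly A b C e) (real \<tau>)"
    and "squared_up_system A b C \<tau> F"
    and "\<gamma> isolated_in system_variety F"
  shows "(\<forall>k. \<gamma> $ k \<noteq> 0 \<longrightarrow>
            2 powr (- eta1 CARD('n) CARD('m) \<tau>) \<le> norm (\<gamma> $ k) \<and>
            norm (\<gamma> $ k) \<le> 2 powr (eta1 CARD('n) CARD('m) \<tau>)) \<and>
         (\<lambda>(n, m, t). eta1 n m t) \<in> soft_bigo (\<lambda>(n, m, t).
            real n ^ 4 * real m ^ 2 * 2 ^ (n * (n + 1) + m) * real t)"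
proof (intro conjI eta1_soft_bigo allI impI)
  fix k assume k: "\<gamma> $ k \<noteq> 0"
  define n where "n = CARD('n)"
  define m where "m = CARD('m)"
  define a where "a = CARD('n uprod)"
  define N where "N = kkt_N n m"
  define p where "p = kkt_p n m"
  \<comment> \<open>Bits of the sum of absolute coefficients of one polynomial:
    \<open>\<tau> + N\<close> from the coefficient bound, and \<open>N + 1\<close> from
    \<open>kkt_size_le\<close>, which also absorbs the factor \<open>p\<close>.\<close>
  define g where "g = \<tau> + 2 * N + 1"
  define \<eta> where "\<eta> = eta_nat N \<tau>"
  have n: "n \<ge> 1" and m: "m \<ge> 1"
    by (simp_all add: n_def m_def Suc_leI)
  have a2: "2 * a = n * (n + 1)"
    unfolding a_def n_def card_UNIV_uprod by simp
  then have a: "a \<ge> 1"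
    using n by (cases a) auto
  have N: "N = 2 * a + m" "N = CARD(('n, 'm) kkt_var)"
    unfolding N_def card_kkt_var n_def[symmetric] m_def[symmetric] by (simp_all add: kkt_N_def a2)
  have p: "p + 1 \<le> m + 3 * a" "p > 0"
  proof -
    have "(3 * n\<^sup>2 + n) div 2 = n\<^sup>2 + a"
      using a2 by (simp add: power2_eq_square)
    moreover have "n\<^sup>2 + 1 \<le> 2 * a"
      using n by (simp add: a2 power2_eq_square)
    ultimately show "p + 1 \<le> m + 3 * a" "p > 0"
      using m by (simp_all add: p_def kkt_p_def)
  qed
  obtain L :: "nat \<Rightarrow> ('n, 'm) kkt_index \<Rightarrow> int" where
      L: "\<And>j. j < N \<Longrightarrow> F j = (\<Sum>e\<in>UNIV. mconst (L j e) * kkt_poly A b C e)"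
    and size: "\<And>j. j < N \<Longrightarrow> coeffs_bitsize_le (F j) (tau1 n m \<tau>)"
    using assms(4) unfolding squared_up_system_def N_def n_def m_def by blast
  have bilinear: "kkt_bilinear (F j)" if "j < N" for j
    unfolding L[OF that] by (intro kkt_bilinear_sum kkt_bilinear_mconst_mult kkt_bilinear_kkt_poly)
  have coeff: "\<bar>Poly_Mapping.lookup (F j) \<alpha>\<bar> \<le> int (2 ^ (\<tau> + N) * p)" if "j < N" for j \<alpha>
  proof -
    have "real_of_int \<bar>Poly_Mapping.lookup (F j) \<alpha>\<bar> \<le> real_of_int (int (2 ^ (\<tau> + N) * p))"
      using size[OF that] two_powr_tau1[of n m \<tau>] p(2)
      by (simp add: coeffs_bitsize_le_def N_def p_def)
    then show ?thesis
      by (simp only: of_int_le_iff)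
  qed
  have G: "(1 + CARD(('n, 'm) kkt_var) + (CARD('n uprod))\<^sup>2) * (2 ^ (\<tau> + N) * p) \<le> 2 ^ g"
  proof -
    have "(1 + CARD(('n, 'm) kkt_var) + (CARD('n uprod))\<^sup>2) * (2 ^ (\<tau> + N) * p) =
        2 ^ (\<tau> + N) * (p * (1 + (2 * a + m) + a\<^sup>2))"
      unfolding N(2)[symmetric] a_def[symmetric] N(1) by (simp only: mult_ac)
    also have "\<dots> \<le> 2 ^ (\<tau> + N) * 2 ^ (2 * a + m + 1)"
      by (intro mult_left_mono kkt_size_le a m p(1)) simp
    also have "\<dots> = 2 ^ g"
      by (simp add: g_def N power_add[symmetric])
    finally show ?thesis .
  qed
  \<comment> \<open>The system is numbered by \<open>j < N\<close>, while a self-map of the space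
    needs components indexed by the variables; both index sets have \<open>N\<close>
    elements.\<close>
  obtain idx :: "('n, 'm) kkt_var \<Rightarrow> nat" where idx: "bij_betw idx UNIV {0..<N}"
    using ex_bij_betw_finite_nat[of "UNIV :: ('n, 'm) kkt_var set"] N(2) by auto
  have idx_less: "idx v < N" for v
    using bij_betwE[OF idx] by auto
  define f where "f v = meval (complex_mpoly (F (idx v)))" for v
  interpret exponent_filtration "kkt_exps :: nat \<Rightarrow> (('n, 'm) kkt_var \<Rightarrow> nat) set" "2 ^ g"
    by (rule kkt_filtration) simp
  have f_expansion: "integral_expansion 1 (f v)" for v
    unfolding f_def using G coeff[OF idx_less]
    by (intro kkt_bilinear_integral_expansion[OF bilinear[OF idx_less], where B = "2 ^ (\<tau> + N) * p"]) simp_all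
  have var_expansion: "integral_expansion 1 (\<lambda>x. x $ k)"
  proof -
    have "(1 + CARD(('n, 'm) kkt_var) + (CARD('n uprod))\<^sup>2) * 1 \<le>
        (1 + CARD(('n, 'm) kkt_var) + (CARD('n uprod))\<^sup>2) * (2 ^ (\<tau> + N) * p)"
      using p(2) by (intro mult_left_mono) (simp_all add: Suc_leI)
    then have "integral_expansion 1 (meval (complex_mpoly (mvar k)))"
      using G by (intro kkt_bilinear_integral_expansion[OF kkt_bilinear_mvar, where B = 1])
        (simp_all add: mvar_def lookup_single when_def)
    moreover have "meval (complex_mpoly (mvar k)) = (\<lambda>x. x $ k)"
      by (rule ext) (simp add: meval_complex_mpoly mvar_def mono_eval_def lookup_single when_def
          if_distrib[of "\<lambda>j. _ ^ j"] cong: if_cong)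
    ultimately show ?thesis
      by simp
  qed
  \<comment> \<open>Bounds the central binomial factor in \<open>card_kkt_exps\<close>, by
    \<open>2 * a \<le> N - 1\<close> and the factor 2 in \<open>central_binomial_le\<close>.\<close>
  define \<beta> :: nat where "\<beta> = 2 ^ (N - 2)"
  have "(N + 1) * \<beta> * g < \<eta>"
    unfolding \<beta>_def g_def \<eta>_def using a m by (intro eta_nat_bound) (simp add: N(1))
  then obtain M where M: "\<And>r. r \<le> \<beta> * ((M + N) choose N) \<Longrightarrow>
      Suc ((2 ^ \<eta> - 1) * (((Suc M + N) choose Suc N) * (2 ^ g) ^ M)) ^ r
        < Suc (2 ^ \<eta> - 1) ^ ((Suc M + N) choose Suc N)"
    using siegel_condition_for_large_degree by blast
  have card: "card (kkt_exps M :: (('n, 'm) kkt_var \<Rightarrow> nat) set) \<le> \<beta> * ((M + N) choose N)"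
  proof -
    have "2 * ((2 * a) choose a) \<le> 2 ^ (2 * a)"
      using a by (intro central_binomial_le) simp
    also have "\<dots> \<le> 2 ^ (N - 1)"
      using m by (intro power_increasing) (simp_all add: N(1))
    also have "\<dots> = 2 * \<beta>"
      using a m by (simp add: \<beta>_def N(1) power_Suc[symmetric] Suc_diff_le numeral_2_eq_2 del: power_Suc)
    finally have "((2 * a) choose a) * ((M + N) choose N) \<le> \<beta> * ((M + N) choose N)"
      by (intro mult_right_mono) simp_all
    then show ?thesis
      using card_kkt_exps[where ?'n = 'n and ?'m = 'm, of M] unfolding a_def[symmetric] m_def[symmetric] N(1)[symmetric]
      by (rule order_trans[rotated])
  qed
  obtain W :: "(('n, 'm) kkt_var \<Rightarrow> nat) \<Rightarrow> nat \<Rightarrow> int" where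
    W: "\<exists>a\<in>exp_box M. \<exists>b\<le>M. W a b \<noteq> 0" "\<forall>a b. \<bar>W a b\<bar> \<le> int (2 ^ \<eta> - 1)"
      "\<forall>x. (\<Sum>a\<in>exp_box M. (\<Sum>b\<le>M. of_int (W a b) * (x $ k) ^ b) * mono_eval a (\<chi> v. f v x)) = 0"
    using small_integer_relation[where f = f, OF f_expansion var_expansion M[OF card] N(2)[THEN arg_cong]]
    by - (elim exE conjE, rule that)
  have variety: "system_variety F = {x. \<forall>v. f v x = 0}"
  proof -
    have "range idx = {..<N}"
      using idx by (simp add: bij_betw_def lessThan_atLeast0)
    then have "{..<kkt_N CARD('n) CARD('m)} = range idx"
      by (simp add: N_def n_def m_def)
    then show ?thesis
      by (auto simp: system_variety_def zero_set_def f_def)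
  qed
  obtain d where d: "\<And>v. polyfun d (f v)"
    using polyfun_meval bilinear[OF idx_less] unfolding f_def by blast
  have zero: "f v \<gamma> = 0" for v
    using assms(5) unfolding variety isolated_in_def by blast
  \<comment> \<open>The height \<open>2 ^ \<eta> - 1\<close> turns the root bound
    \<open>real h + 1\<close> into exactly \<open>2 ^ \<eta>\<close>.\<close>
  have h: "real (2 ^ \<eta> - 1) + 1 = 2 ^ \<eta>"
    by (simp add: of_nat_diff)
  have "1 / 2 ^ \<eta> \<le> norm (\<gamma> $ k) \<and> norm (\<gamma> $ k) \<le> 2 ^ \<eta>"
    using relation_bounds_isolated_zero[OF d zero assms(5)[unfolded variety] W(1) W(2)[rule_format] W(3)[rule_format] k]
    unfolding h .
  then show "2 powr (- eta1 CARD('n) CARD('m) \<tau>) \<le> norm (\<gamma> $ k)"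
    and "norm (\<gamma> $ k) \<le> 2 powr (eta1 CARD('n) CARD('m) \<tau>)"
    by (simp_all add: eta1_eq_eta_nat powr_minus powr_realpow divide_inverse \<eta>_def N_def n_def m_def)
qed

end
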